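(* For every integer $d \geq 2$ and all $k, m \in \mathbb{N}_{+}$, there is a strategy for Presenter in the on-line $(k,d)$ interval coloring game that forces Algorithm to use at least $(5m-3)\frac{d}{\log d + 3}$ different colors while the constructed set of intervals is $m\left(\frac{d}{k} + \log d + 3\right)$-colorable. Here $\log$ denotes the logarithm to base $2$.
   Context: Intervals are closed intervals $[l,r]$ on the real line. Each interval carries a $d$-dimensional vector of weights from $[0,1]^d$. Intervals are treated as individual objects: several presented intervals may have the same endpoints. A $(k,d)$-coloring of a finite collection of weighted intervals is an assignment of colors to the intervals such that for each color $\gamma$ and each point $p$ of the real line: the number of intervals containing $p$ and colored $\gamma$ does not exceed $k$, and the sum of the weight vectors of the intervals containing $p$ and colored $\gamma$ does not exceed $1$ in any of the $d$ coordinates. For a real number $x$, a finite collection of weighted intervals is $x$-colorable if it has a $(k,d)$-coloring using at most $x$ colors. The on-line $(k,d)$ interval coloring game is played by Presenter and Algorithm. In each round Presenter introduces a new interval with a $d$-dimensional vector of weights from $[0,1]$. Algorithm irrevocably assigns a color to it, before the next interval is introduced, so that the coloring of all intervals presented so far is a $(k,d)$-coloring. Algorithm may use any number of colors and aims to minimize the number of different colors used. Presenter presents finitely many intervals and then the game ends. A strategy for Presenter "forces Algorithm to use at least $c$ colors while the constructed set of intervals is $x$-colorable" if, whatever valid choices Algorithm makes, at the end of the game played against this strategy Algorithm has used at least $c$ different colors and the collection of all presented weighted intervals is $x$-colorable. *)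

theory Defs
  imports Complex_Main "HOL-Library.FuncSet"
begin

datatype winterval = WInterval (left_end: real) (right_end: real) (weight: "nat \<Rightarrow> real")

definition points :: "winterval \<Rightarrow> real set" where
  "points v = {left_end v..right_end v}"

text \<open>Vectors in $[0,1]^d$ are functions on the index set \<open>{..<d}\<close>, extensional outside it.\<close>

definition is_winterval :: "nat \<Rightarrow> winterval \<Rightarrow> bool" where
  "is_winterval d v \<longleftrightarrow>
     left_end v \<le> right_end v \<and> weight v \<in> (\<Pi>\<^sub>E j\<in>{..<d}. {0..1})"

text \<open>
  A finite collection is a list, and its members are identified by their positions, so that equal
  intervals remain distinct objects. A coloring maps positions to colors.
\<close>

definition at_point :: "winterval list \<Rightarrow> (nat \<Rightarrow> nat) \<Rightarrow> nat \<Rightarrow> real \<Rightarrow> nat set" where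
  "at_point vs col \<gamma> p = {i. i < length vs \<and> p \<in> points (vs ! i) \<and> col i = \<gamma>}"

definition kd_coloring :: "nat \<Rightarrow> nat \<Rightarrow> winterval list \<Rightarrow> (nat \<Rightarrow> nat) \<Rightarrow> bool" where
  "kd_coloring k d vs col \<longleftrightarrow>
     (\<forall>\<gamma> p. card (at_point vs col \<gamma> p) \<le> k \<and>
            (\<forall>j<d. (\<Sum>i\<in>at_point vs col \<gamma> p. weight (vs ! i) j) \<le> 1))"

definition colorable :: "nat \<Rightarrow> nat \<Rightarrow> real \<Rightarrow> winterval list \<Rightarrow> bool" where
  "colorable k d x vs \<longleftrightarrow>
     (\<exists>col. kd_coloring k d vs col \<and> real (card (col ` {..<length vs})) \<le> x)"

text \<open>
  A history lists the rounds so far, oldest first, each with the presented interval and the color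
  chosen by Algorithm. A strategy of Presenter maps a history to the next interval, or to
  \<open>None\<close> to end the game.
\<close>

type_synonym history = "(winterval \<times> nat) list"
type_synonym strategy = "history \<Rightarrow> winterval option"

definition intervals :: "history \<Rightarrow> winterval list" where
  "intervals h = map fst h"

definition color_of :: "history \<Rightarrow> nat \<Rightarrow> nat" where
  "color_of h i = snd (h ! i)"

text \<open>Histories reachable when Presenter follows \<open>\<sigma>\<close> and Algorithm answers validly.\<close>

inductive play :: "nat \<Rightarrow> nat \<Rightarrow> strategy \<Rightarrow> history \<Rightarrow> bool" for k d \<sigma> where
  start: "play k d \<sigma> []"
| round: "play k d \<sigma> h \<Longrightarrow> \<sigma> h = Some v \<Longrightarrow>
    kd_coloring k d (intervals (h @ [(v, c)])) (color_of (h @ [(v, c)])) \<Longrightarrow>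
    play k d \<sigma> (h @ [(v, c)])"

text \<open>
  The second conjunct excludes infinite plays; the number of rounds may still depend on
  Algorithm's choices.
\<close>

definition presenter_strategy :: "nat \<Rightarrow> nat \<Rightarrow> strategy \<Rightarrow> bool" where
  "presenter_strategy k d \<sigma> \<longleftrightarrow>
     (\<forall>h v. play k d \<sigma> h \<longrightarrow> \<sigma> h = Some v \<longrightarrow> is_winterval d v) \<and>
     \<not> (\<exists>f. \<forall>n. play k d \<sigma> (map f [0..<n]))"

definition forces :: "nat \<Rightarrow> nat \<Rightarrow> strategy \<Rightarrow> real \<Rightarrow> real \<Rightarrow> bool" where
  "forces k d \<sigma> c x \<longleftrightarrow>
     (\<forall>h. play k d \<sigma> h \<longrightarrow> \<sigma> h = None \<longrightarrow>
        c \<le> real (card (set (map snd h))) \<and> colorable k d x (intervals h))"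

end

theory Submission imports Defs begin

text \<open>
  Presenter plays bundles of at most \<open>d\<close> intervals with common endpoints. Within a bundle the weights realise
  the Halldorsson--Szegedy lower bound for on-line graph coloring: the items carry hidden classes
  out of \<open>2 * s\<close> many, where \<open>2 * s\<close> is about \<open>log d + 3\<close>, and item \<open>t\<close> conflicts with the earlier items
  whose class lies outside a chosen \<open>s\<close>-subset \<open>S\<close> of the classes. Taking \<open>S\<close> different from the
  class set of every color in use, and the class of \<open>t\<close> in \<open>S\<close> but new for the color it received,
  ensures that every color is used at most \<open>s\<close> times. So a bundle needs \<open>q = d / s\<close> colors on-line,
  while off-line its classes, cut into pieces of size \<open>k\<close>, give at most \<open>d div k + 2 * s\<close> colors.
  Choosing each bundle's weights tiny compared to all earlier ones, intersecting bundles are forced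
  to use disjoint sets of colors.

  The bundles are arranged as in the Kierstead--Trotter lower bound. Repeat the strategy for \<open>m\<close>
  levels in many disjoint regions, until four of them carry the same set of colors. Cover the
  first and the fourth of these by one bundle each, and then the gap between the two by one
  bundle or by two touching ones, depending on how many colors the outer bundles share. This
  forces \<open>5 * q / 2\<close> new colors and adds one level. Since at most \<open>m\<close> bundles meet in a point, off-line
  \<open>m\<close> palettes suffice.
\<close>

subsection \<open>Strategies from forceable positions\<close>

definition valid :: "nat \<Rightarrow> nat \<Rightarrow> history \<Rightarrow> bool" where
  "valid k d h \<longleftrightarrow> kd_coloring k d (intervals h) (color_of h)"

text \<open>An inductive definition makes the game tree well-founded: every play ends, although no
  bound on its length is fixed in advance. Goals can be chained before any strategy function is
  named.\<close>

inductive forceable :: "nat \<Rightarrow> nat \<Rightarrow> (history \<Rightarrow> bool) \<Rightarrow> history \<Rightarrow> bool" for k d P where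
  stop: "P h \<Longrightarrow> forceable k d P h"
| step: "is_winterval d v \<Longrightarrow>
    (\<And>c. valid k d (h @ [(v, c)]) \<Longrightarrow> forceable k d P (h @ [(v, c)])) \<Longrightarrow> forceable k d P h"

inductive wins :: "nat \<Rightarrow> nat \<Rightarrow> strategy \<Rightarrow> (history \<Rightarrow> bool) \<Rightarrow> history \<Rightarrow> bool"
  for k d \<sigma> P where
  halt: "\<sigma> h = None \<Longrightarrow> P h \<Longrightarrow> wins k d \<sigma> P h"
| move: "\<sigma> h = Some v \<Longrightarrow> is_winterval d v \<Longrightarrow>
    (\<And>c. valid k d (h @ [(v, c)]) \<Longrightarrow> wins k d \<sigma> P (h @ [(v, c)])) \<Longrightarrow> wins k d \<sigma> P h"

text \<open>Only the values on extensions of \<open>h\<close> matter, which allows strategies for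
  different answers to be glued together.\<close>

lemma wins_cong:
  assumes "wins k d \<sigma> P h" and "\<And>t. \<sigma>' (h @ t) = \<sigma> (h @ t)"
  shows "wins k d \<sigma>' P h"
  using assms
proof (induction rule: wins.induct)
  case (halt h)
  then show ?case using halt(3)[of "[]"] by (auto intro: wins.halt)
next
  case (move h v)
  show ?case
  proof (rule wins.move)
    show "\<sigma>' h = Some v" using move.prems[of "[]"] move.hyps by simp
    show "is_winterval d v" by fact
    fix c assume "valid k d (h @ [(v, c)])"
    then show "wins k d \<sigma>' P (h @ [(v, c)])"
      using move.prems[of "(v, c) # t" for t] by (intro move.IH) auto
  qed
qed

lemma forceable_imp_wins:
  assumes "forceable k d P h"
  shows "\<exists>\<sigma>. wins k d \<sigma> P h"
  using assms
proof (induction rule: forceable.induct)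
  case (stop h)
  then show ?case by (intro exI[of _ "\<lambda>_. None"]) (auto intro: wins.halt)
next
  case (step v h)
  then have "\<forall>c. \<exists>\<sigma>. valid k d (h @ [(v, c)]) \<longrightarrow> wins k d \<sigma> P (h @ [(v, c)])"
    by blast
  then obtain \<tau> where \<tau>: "\<And>c. valid k d (h @ [(v, c)]) \<Longrightarrow> wins k d (\<tau> c) P (h @ [(v, c)])"
    by metis
  \<comment> \<open>The entry at position \<open>length h\<close> holds Algorithm's answer to
    \<open>v\<close>, so it tells which of the strategies \<open>\<tau> c\<close> is being
    followed.\<close>
  define \<sigma> where "\<sigma> h' = (if h' = h then Some v else \<tau> (snd (h' ! length h)) h')" for h'
  have "wins k d \<sigma> P h"
  proof (rule wins.move)
    show "\<sigma> h = Some v" by (simp add: \<sigma>_def)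
    fix c assume "valid k d (h @ [(v, c)])"
    then show "wins k d \<sigma> P (h @ [(v, c)])"
      by (rule wins_cong[OF \<tau>]) (simp add: \<sigma>_def)
  qed (fact step)
  then show ?case by blast
qed

text \<open>An infinite play through \<open>h\<close> must pass through some position
  \<open>h @ [(v, c)]\<close>, so induction along the well-founded \<open>wins\<close> excludes
  it.\<close>

lemma wins_no_infinite_play:
  assumes "wins k d \<sigma> P h" and "map f [0..<length h] = h"
  shows "\<exists>n. \<not> play k d \<sigma> (map f [0..<n])"
  using assms
proof (induction rule: wins.induct)
  case (halt h)
  have "\<not> play k d \<sigma> (map f [0..<Suc (length h)])"
  proof
    assume "play k d \<sigma> (map f [0..<Suc (length h)])"
    then show False using halt by cases auto
  qed
  then show ?case by blast
next
  case (move h v)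
  show ?case
  proof (rule ccontr)
    assume "\<not> ?thesis"
    then have all: "\<And>n. play k d \<sigma> (map f [0..<n])" by blast
    have "play k d \<sigma> (map f [0..<Suc (length h)])" by (rule all)
    then obtain c where c: "f (length h) = (v, c)" "valid k d (h @ [(v, c)])"
      using move.hyps move.prems by cases (auto simp: valid_def)
    have "\<exists>n. \<not> play k d \<sigma> (map f [0..<n])"
      using c move.prems by (intro move.IH[of c]) auto
    with all show False by blast
  qed
qed

lemma wins_play:
  assumes "wins k d \<sigma> P []" and "play k d \<sigma> h"
  shows "wins k d \<sigma> P h"
  using assms(2)
proof (induction rule: play.induct)
  case start
  show ?case by fact
next
  case (round h v c)
  from round.IH show ?case
    by cases (use round.hyps in \<open>auto simp: valid_def\<close>)
qed

lemma forceable_imp_strategy: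
  assumes "forceable k d P []"
  shows "\<exists>\<sigma>. presenter_strategy k d \<sigma> \<and> (\<forall>h. play k d \<sigma> h \<longrightarrow> \<sigma> h = None \<longrightarrow> P h)"
proof -
  obtain \<sigma> where w: "wins k d \<sigma> P []"
    using forceable_imp_wins[OF assms] by blast
  have "is_winterval d v" if "play k d \<sigma> h" "\<sigma> h = Some v" for h v
    using wins_play[OF w that(1)] that(2) by cases auto
  moreover have "P h" if "play k d \<sigma> h" "\<sigma> h = None" for h
    using wins_play[OF w that(1)] that(2) by cases auto
  moreover have "\<not> (\<exists>f. \<forall>n. play k d \<sigma> (map f [0..<n]))"
    using wins_no_infinite_play[OF w] by auto
  ultimately show ?thesis
    unfolding presenter_strategy_def by blast
qed

lemma forceable_trans:
  assumes "forceable k d P h" and "\<And>h'. P h' \<Longrightarrow> forceable k d Q h'"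
  shows "forceable k d Q h"
  using assms by (induction rule: forceable.induct) (auto intro: forceable.step)

subsection \<open>The game on blocks\<close>

type_synonym block = "real \<times> real \<times> nat set"

text \<open>
  A block \<open>(l, r, D)\<close> abstracts a bundle of intervals with the common endpoints \<open>l\<close> and \<open>r\<close>,
  on which Algorithm has used the set \<open>D\<close> of colors. In the game on blocks, Algorithm answers an
  interval with any set of at least \<open>q\<close> colors avoiding those of the blocks it meets.
\<close>

inductive block_forceable :: "real \<Rightarrow> (block list \<Rightarrow> bool) \<Rightarrow> block list \<Rightarrow> bool" for q P where
  stop: "P bs \<Longrightarrow> block_forceable q P bs"
| step: "l \<le> r \<Longrightarrow>
    (\<And>D. finite D \<Longrightarrow> q \<le> real (card D) \<Longrightarrow>
      \<forall>(l', r', D')\<in>set bs. l \<le> r' \<longrightarrow> l' \<le> r \<longrightarrow> D \<inter> D' = {} \<Longrightarrow>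
      block_forceable q P (bs @ [(l, r, D)])) \<Longrightarrow> block_forceable q P bs"

lemma block_forceable_trans:
  assumes "block_forceable q P bs" and "\<And>bs'. P bs' \<Longrightarrow> block_forceable q Q bs'"
  shows "block_forceable q Q bs"
  using assms by (induction rule: block_forceable.induct) (auto intro: block_forceable.step)

definition load :: "block list \<Rightarrow> real \<Rightarrow> nat" where
  "load bs p = length (filter (\<lambda>(l, r, D). l \<le> p \<and> p \<le> r) bs)"

definition cols :: "block list \<Rightarrow> nat set" where
  "cols bs = (\<Union>(l, r, D)\<in>set bs. D)"

text \<open>Strictness keeps the endpoints of a region free of blocks, so that later blocks may
  touch each other there at no cost in load.\<close>

definition inside :: "real \<Rightarrow> real \<Rightarrow> block \<Rightarrow> bool" where
  "inside a b = (\<lambda>(l, r, D). a < l \<and> l \<le> r \<and> r < b \<and> finite D)"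

lemma load_append [simp]: "load (bs @ cs) p = load bs p + load cs p"
  by (simp add: load_def)

lemma load_Nil [simp]: "load [] p = 0"
  by (simp add: load_def)

lemma load_Cons [simp]:
  "load ((l, r, D) # bs) p = (if l \<le> p \<and> p \<le> r then 1 else 0) + load bs p"
  by (simp add: load_def)

lemma load_eq_0:
  assumes "\<And>l r D. (l, r, D) \<in> set bs \<Longrightarrow> p < l \<or> r < p"
  shows "load bs p = 0"
  using assms by (force simp: load_def filter_empty_conv)

lemma cols_append [simp]: "cols (bs @ cs) = cols bs \<union> cols cs"
  by (auto simp: cols_def)

lemma cols_simps [simp]: "cols [] = {}" "cols ((l, r, D) # bs) = D \<union> cols bs"
  by (auto simp: cols_def)

lemma finite_cols: "\<forall>t\<in>set bs. \<exists>a b. inside a b t \<Longrightarrow> finite (cols bs)"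
  by (force simp: cols_def inside_def)

lemma cols_filter_subset: "cols (filter P bs) \<subseteq> cols bs"
  by (auto simp: cols_def)

section \<open>Adding a level: regions with equal color sets\<close>

text \<open>The strategy is run region by region from left to right. Blocks from different regions
  share no point, so the load bound \<open>m\<close> survives, and the filters recover the colors of
  each region.\<close>

lemma separated_regions:
  fixes x :: "nat \<Rightarrow> real"
  assumes IH: "\<And>a b bs. a < b \<Longrightarrow> block_forceable q
      (\<lambda>bs'. \<exists>e. bs' = bs @ e \<and> (\<forall>t\<in>set e. inside a b t) \<and> (\<forall>p. load e p \<le> m) \<and>
        T \<le> real (card (cols e))) bs"
    and x: "strict_mono x"
  shows "block_forceable q
      (\<lambda>bs'. \<exists>e. bs' = bs @ e \<and> (\<forall>t\<in>set e. \<exists>j<n. inside (x j) (x (Suc j)) t) \<and>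
        (\<forall>p. load e p \<le> m) \<and>
        (\<forall>j<n. T \<le> real (card (cols (filter (inside (x j) (x (Suc j))) e))))) bs"
proof (induction n)
  case 0
  show ?case by (rule block_forceable.stop) (auto intro!: exI[of _ "[]"])
next
  case (Suc n)
  show ?case
  proof (rule block_forceable_trans[OF Suc.IH], elim exE conjE)
    fix bs' e
    assume bs': "bs' = bs @ e"
      and e: "\<forall>t\<in>set e. \<exists>j<n. inside (x j) (x (Suc j)) t"
      and le: "\<forall>p. load e p \<le> m"
      and ce: "\<forall>j<n. T \<le> real (card (cols (filter (inside (x j) (x (Suc j))) e)))"
    have lt: "x n < x (Suc n)" using x by (simp add: strict_mono_def)
    show "block_forceable q
      (\<lambda>bs'. \<exists>e. bs' = bs @ e \<and> (\<forall>t\<in>set e. \<exists>j<Suc n. inside (x j) (x (Suc j)) t) \<and>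
        (\<forall>p. load e p \<le> m) \<and>
        (\<forall>j<Suc n. T \<le> real (card (cols (filter (inside (x j) (x (Suc j))) e))))) bs'"
    proof (rule block_forceable_trans[OF IH[OF lt, of bs']], elim exE conjE, rule block_forceable.stop)
      fix bs'' f
      assume bs'': "bs'' = bs' @ f"
        and f: "\<forall>t\<in>set f. inside (x n) (x (Suc n)) t"
        and lf: "\<forall>p. load f p \<le> m"
        and cf: "T \<le> real (card (cols f))"
      have right: "r < x n" if "(l, r, D) \<in> set e" for l r D
      proof -
        obtain j where j: "j < n" "inside (x j) (x (Suc j)) (l, r, D)" using e \<open>(l, r, D) \<in> set e\<close> by blast
        then have "x (Suc j) \<le> x n" using x by (simp add: strict_mono_less_eq)
        with j show ?thesis by (auto simp: inside_def)
      qed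
      have "load (e @ f) p \<le> m" for p
      proof (cases "x n < p")
        case True
        then have "load e p = 0" using right by (intro load_eq_0) force
        then show ?thesis using lf by simp
      next
        case False
        then have "load f p = 0" using f by (intro load_eq_0) (force simp: inside_def)
        then show ?thesis using le by simp
      qed
      moreover have "T \<le> real (card (cols (filter (inside (x j) (x (Suc j))) (e @ f))))"
        if j: "j < Suc n" for j
      proof (cases "j = n")
        case True
        have "filter (inside (x n) (x (Suc n))) f = f" using f by simp
        moreover have "filter (inside (x n) (x (Suc n))) e = []"
          using right by (force simp: filter_empty_conv inside_def)
        ultimately show ?thesis using cf True by simp
      next
        case False
        then have "x (Suc j) \<le> x n" using x j by (simp add: strict_mono_less_eq)
        then have "filter (inside (x j) (x (Suc j))) f = []"
          using f by (force simp: filter_empty_conv inside_def)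
        then show ?thesis using ce False j by simp
      qed
      moreover have "\<forall>t\<in>set (e @ f). \<exists>j<Suc n. inside (x j) (x (Suc j)) t"
        using e f less_Suc_eq by auto
      ultimately show "\<exists>e. bs'' = bs @ e \<and> (\<forall>t\<in>set e. \<exists>j<Suc n. inside (x j) (x (Suc j)) t) \<and>
        (\<forall>p. load e p \<le> m) \<and>
        (\<forall>j<Suc n. T \<le> real (card (cols (filter (inside (x j) (x (Suc j))) e))))"
        using bs' bs'' by (intro exI[of _ "e @ f"]) auto
    qed
  qed
qed

text \<open>Pigeonhole: if every value were taken at most three times, there would be at most
  \<open>3 * card V\<close> indices.\<close>

lemma four_equal_values:
  fixes f :: "nat \<Rightarrow> 'a"
  assumes "finite V" and "\<And>j. j < n \<Longrightarrow> f j \<in> V" and "3 * card V < n"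
  obtains j1 j2 j3 j4 where "j1 < j2" "j2 < j3" "j3 < j4" "j4 < n"
    "f j2 = f j1" "f j3 = f j1" "f j4 = f j1"
proof -
  have "\<exists>y\<in>V. 3 < card {j. j < n \<and> f j = y}"
  proof (rule ccontr)
    assume "\<not> ?thesis"
    then have "(\<Sum>y\<in>V. card {j. j < n \<and> f j = y}) \<le> (\<Sum>y\<in>V. 3)"
      by (intro sum_mono) (simp add: not_less)
    moreover have "card (\<Union>y\<in>V. {j. j < n \<and> f j = y}) \<le> (\<Sum>y\<in>V. card {j. j < n \<and> f j = y})"
      by (rule card_UN_le) fact
    moreover have "(\<Union>y\<in>V. {j. j < n \<and> f j = y}) = {..<n}" using assms(2) by auto
    ultimately show False using assms(3) by simp
  qed
  then obtain y where y: "3 < card {j. j < n \<and> f j = y}" by blast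
  define js where "js = sorted_list_of_set {j. j < n \<and> f j = y}"
  have len: "3 < length js" using y by (simp add: js_def)
  have lt: "js ! i < js ! i'" if "i < i'" "i' < length js" for i i'
    using that sorted_wrt_nth_less[of "(<)" js] by (simp add: js_def strict_sorted_list_of_set)
  have mem: "js ! i < n \<and> f (js ! i) = y" if "i \<le> 3" for i
    using nth_mem[of i js] that len by (simp add: js_def)
  show ?thesis
    by (rule that[of "js ! 0" "js ! 1" "js ! 2" "js ! 3"]) (use len lt mem[of 0] mem[of 1] mem[of 2] mem[of 3] in auto)
qed

lemma card_disjoint_Un3:
  assumes "finite A" "finite B" "finite C" "A \<inter> B = {}" "A \<inter> C = {}" "B \<inter> C = {}"
  shows "card (A \<union> (B \<union> C)) = card A + (card B + card C)"
proof -
  have "card (A \<union> (B \<union> C)) = card A + card (B \<union> C)"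
    using assms by (intro card_Un_disjoint) auto
  also have "card (B \<union> C) = card B + card C"
    using assms by (intro card_Un_disjoint) auto
  finally show ?thesis .
qed

text \<open>Induction on \<open>m\<close>: one block gives \<open>q = 2 * (q / 2)\<close> colors,
  and each further level gains \<open>5 * q / 2\<close> at the price of one unit of load. The region
  and the past \<open>bs\<close> are arbitrary, since the strategy is repeated in many
  places.\<close>

lemma force_blocks:
  fixes q :: real
  assumes "m \<ge> 1" and "q \<ge> 0" and "a < b"
  shows "block_forceable q (\<lambda>bs'. \<exists>e. bs' = bs @ e \<and> (\<forall>t\<in>set e. inside a b t) \<and>
    (\<forall>p. load e p \<le> m) \<and> (5 * real m - 3) * (q / 2) \<le> real (card (cols e))) bs"
  using assms(1,3)
proof (induction m arbitrary: a b bs rule: dec_induct)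
  case base
  define l where "l = (a + b) / 2"
  have l: "a < l" "l < b" using base by (auto simp: l_def)
  show ?case
  proof (rule block_forceable.step[of l l])
    fix D :: "nat set"
    assume "finite D" "q \<le> real (card D)"
    with l show "block_forceable q (\<lambda>bs'. \<exists>e. bs' = bs @ e \<and> (\<forall>t\<in>set e. inside a b t) \<and>
      (\<forall>p. load e p \<le> 1) \<and> (5 * real 1 - 3) * (q / 2) \<le> real (card (cols e))) (bs @ [(l, l, D)])"
      by (intro block_forceable.stop exI[of _ "[(l, l, D)]"]) (auto simp: inside_def)
  qed simp
next
  case (step m)
  define T where "T = (5 * real m - 3) * (q / 2)"
  define T' where "T' = (5 * real (Suc m) - 3) * (q / 2)"
  have T': "T' = T + 5 * q / 2" by (simp add: T_def T'_def algebra_simps)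
  \<comment> \<open>While the regions show fewer than \<open>T'\<close> colors, each region has one
    of at most \<open>2 ^ N\<close> color sets, so among \<open>3 * 2 ^ N + 1\<close> regions four
    have equal sets.\<close>
  define N where "N = nat \<lceil>T'\<rceil>"
  define n where "n = Suc (3 * 2 ^ N)"
  \<comment> \<open>Dividing by \<open>n + 2\<close> leaves a margin \<open>w\<close> at both ends,
    so \<open>x 0\<close>, ..., \<open>x n\<close> lie strictly between \<open>a\<close> and
    \<open>b\<close>.\<close>
  define w where "w = (b - a) / (real n + 2)"
  define x where "x j = a + (real j + 1) * w" for j
  have w: "w > 0" using step.prems by (simp add: w_def)
  have x: "strict_mono x" using w by (auto simp: strict_mono_def x_def)
  have xa: "a < x j" for j using w by (simp add: x_def add_pos_nonneg)
  have xb: "x j < b" if "j \<le> n" for j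
  proof -
    have "(real j + 1) * w < (real n + 2) * w" using that w by (intro mult_strict_right_mono) auto
    also have "\<dots> = b - a" by (simp add: w_def)
    finally show ?thesis by (simp add: x_def)
  qed
  let ?goal = "\<lambda>bs'. \<exists>e. bs' = bs @ e \<and> (\<forall>t\<in>set e. inside a b t) \<and>
    (\<forall>p. load e p \<le> Suc m) \<and> T' \<le> real (card (cols e))"
  have "block_forceable q ?goal bs"
  proof (rule block_forceable_trans[OF separated_regions[OF step.IH x, where n = n]], assumption,
      elim exE conjE, unfold T_def[symmetric])
    fix bs' e
    assume bs': "bs' = bs @ e"
      and e: "\<forall>t\<in>set e. \<exists>j<n. inside (x j) (x (Suc j)) t"
      and le: "\<forall>p. load e p \<le> m"
      and ce: "\<forall>j<n. T \<le> real (card (cols (filter (inside (x j) (x (Suc j))) e)))"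
    have fin: "finite (cols e)" using e by (intro finite_cols) blast
    have "inside a b t" if t: "t \<in> set e" for t
    proof -
      obtain j where j: "j < n" "inside (x j) (x (Suc j)) t" using e t by blast
      then show ?thesis using xa[of j] xb[of "Suc j"] by (auto simp: inside_def)
    qed
    then have e_in: "\<forall>t\<in>set e. inside a b t" by blast
    have load_x: "load e (x i) = 0" for i
    proof (rule load_eq_0)
      fix l r D assume "(l, r, D) \<in> set e"
      then obtain j where j: "inside (x j) (x (Suc j)) (l, r, D)" using e by blast
      show "x i < l \<or> r < x i"
      proof (cases "i \<le> j")
        case True
        then have "x i \<le> x j" using x by (simp add: strict_mono_less_eq)
        with j show ?thesis by (auto simp: inside_def)
      next
        case False
        then have "x (Suc j) \<le> x i" using x by (simp add: strict_mono_less_eq)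
        with j show ?thesis by (auto simp: inside_def)
      qed
    qed
    define C where "C j = cols (filter (inside (x j) (x (Suc j))) e)" for j
    have Csub: "C j \<subseteq> cols e" for j by (simp add: C_def cols_filter_subset)
    show "block_forceable q ?goal bs'"
    proof (cases "T' \<le> real (card (cols e))")
      \<comment> \<open>If the regions together already show \<open>T'\<close> colors, Presenter
        adds no block.\<close>
      case True
      then show ?thesis using bs' e_in le
        by (intro block_forceable.stop exI[of _ e]) (auto intro: le_SucI)
    next
      case False
      then have "card (cols e) \<le> N" by (simp add: N_def) linarith
      then have "card (Pow (cols e)) \<le> 2 ^ N" using fin by (simp add: card_Pow)
      then have "3 * card (Pow (cols e)) < n" by (simp add: n_def)
      then obtain j1 j2 j3 j4 where j: "j1 < j2" "j2 < j3" "j3 < j4" "j4 < n"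
        and C: "C j2 = C j1" "C j3 = C j1" "C j4 = C j1"
        using four_equal_values[of "Pow (cols e)" n C] fin Csub by blast
      define E where "E = C j1"
      have E: "T \<le> real (card E)" "finite E"
        using ce j Csub[of j1] fin by (auto simp: E_def C_def intro: finite_subset)
      have xs: "x j1 < x (Suc j1)" "x (Suc j1) \<le> x j2" "x j2 < x (Suc j2)" "x (Suc j2) \<le> x j3"
        "x j3 < x (Suc j3)" "x (Suc j3) \<le> x j4" "x j4 < x (Suc j4)"
        using x j by (simp_all add: strict_mono_less_eq strict_mono_less)
      have ends: "a < x j1" "x (Suc j4) < b" using xa xb j by auto
      \<comment> \<open>A block covering a whole region meets all blocks inside it, hence its colors
        avoid the entire set \<open>C i\<close>.\<close>
      have avoid: "D \<inter> E = {}"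
        if D: "\<forall>(l', r', D')\<in>set (bs' @ f). l \<le> r' \<longrightarrow> l' \<le> r \<longrightarrow> D \<inter> D' = {}"
          and i: "C i = E" "l \<le> x i" "x (Suc i) \<le> r" for D f l r i
      proof -
        have "D \<inter> D' = {}" if "(l', r', D') \<in> set e" "inside (x i) (x (Suc i)) (l', r', D')" for l' r' D'
        proof -
          have "(l', r', D') \<in> set (bs' @ f)" using that(1) bs' by simp
          with D have "l \<le> r' \<longrightarrow> l' \<le> r \<longrightarrow> D \<inter> D' = {}" by blast
          then show ?thesis using that(2) i by (auto simp: inside_def)
        qed
        then have "D \<inter> C i = {}" by (fastforce simp: C_def cols_def)
        with i show ?thesis by simp
      qed
      \<comment> \<open>The new blocks overlap only at points of \<open>range x\<close>, which the blocks of \<open>e\<close> avoid.\<close>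
      have finish: "?goal (bs' @ f)"
        if "\<forall>t\<in>set f. inside a b t" "\<forall>p. load f p \<le> 2" "\<forall>p. p \<notin> range x \<longrightarrow> load f p \<le> 1"
          "T' \<le> real (card (E \<union> cols f))" for f
      proof -
        have "load (e @ f) p \<le> Suc m" for p
          using that(2)[rule_format, of p] that(3)[rule_format, of p] le[rule_format, of p] load_x step.hyps
          by (cases "p \<in> range x") auto
        moreover have "card (E \<union> cols f) \<le> card (cols (e @ f))"
          using fin that(1) Csub[of j1] by (intro card_mono) (auto simp: E_def intro!: finite_cols)
        ultimately show ?thesis
          using that(1,4) e_in bs' by (intro exI[of _ "e @ f"]) auto
      qed
      show ?thesis
      proof (rule block_forceable.step[of "x j1" "x (Suc j1)"])
        fix D1
        assume D1: "finite D1" "q \<le> real (card D1)"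
          "\<forall>(l', r', D')\<in>set bs'. x j1 \<le> r' \<longrightarrow> l' \<le> x (Suc j1) \<longrightarrow> D1 \<inter> D' = {}"
        let ?B1 = "(x j1, x (Suc j1), D1)"
        have D1E: "D1 \<inter> E = {}" using D1(3) avoid[of "[]" _ _ _ j1] by (auto simp: E_def)
        show "block_forceable q ?goal (bs' @ [?B1])"
        proof (rule block_forceable.step[of "x j4" "x (Suc j4)"])
          fix D4
          assume D4: "finite D4" "q \<le> real (card D4)"
            "\<forall>(l', r', D')\<in>set (bs' @ [?B1]). x j4 \<le> r' \<longrightarrow> l' \<le> x (Suc j4) \<longrightarrow> D4 \<inter> D' = {}"
          let ?B4 = "(x j4, x (Suc j4), D4)"
          have D4E: "D4 \<inter> E = {}" using avoid[OF D4(3), of j4] C by (auto simp: E_def)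
          show "block_forceable q ?goal ((bs' @ [?B1]) @ [?B4])"
          \<comment> \<open>The best threshold: with \<open>x\<close> colors on the two outer blocks, a single block between
            them yields \<open>x + q\<close> new colors, and two blocks between them yield \<open>4 * q - x\<close>.\<close>
          proof (cases "3 * q / 2 \<le> real (card (D1 \<union> D4))")
            case True
            \<comment> \<open>The block played next touches both outer blocks and covers region
              \<open>j2\<close>, so its colors avoid \<open>D1\<close>, \<open>D4\<close> and
              \<open>E\<close>: the gain is at least \<open>3 * q / 2 + q\<close>.\<close>
            show ?thesis
            proof (rule block_forceable.step[of "x (Suc j1)" "x j4"])
              fix D
              assume D: "finite D" "q \<le> real (card D)"
                "\<forall>(l', r', D')\<in>set ((bs' @ [?B1]) @ [?B4]).
                  x (Suc j1) \<le> r' \<longrightarrow> l' \<le> x j4 \<longrightarrow> D \<inter> D' = {}"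
              let ?f = "[?B1, ?B4, (x (Suc j1), x j4, D)]"
              have DE: "D \<inter> E = {}"
                using avoid[of "[?B1, ?B4]" "x (Suc j1)" "x j4" D j2] D(3) C xs by (auto simp: E_def)
              have D14: "D \<inter> D1 = {}" "D \<inter> D4 = {}" using D(3) xs by auto
              have "card (E \<union> cols ?f) = card (E \<union> ((D1 \<union> D4) \<union> D))"
                by (rule arg_cong[where f = card]) auto
              also have "\<dots> = card E + (card (D1 \<union> D4) + card D)"
                using E D1(1) D4(1) D(1) D1E D4E DE D14
                by (subst card_disjoint_Un3) auto
              finally have "T' \<le> real (card (E \<union> cols ?f))"
                using E D(2) True by (simp add: T')
              moreover have "\<forall>t\<in>set ?f. inside a b t"
                using xs ends D1(1) D4(1) D(1) by (simp add: inside_def)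
              moreover have "load ?f p \<le> 2" for p using xs by simp
              moreover have "load ?f p \<le> 1" if "p \<notin> range x" for p
              proof -
                have "p \<noteq> x (Suc j1)" "p \<noteq> x j3" "p \<noteq> x j4" using that by auto
                with xs show ?thesis by simp
              qed
              ultimately have "?goal (bs' @ ?f)" by (intro finish) blast+
              then show "block_forceable q ?goal (((bs' @ [?B1]) @ [?B4]) @ [(x (Suc j1), x j4, D)])"
                by (intro block_forceable.stop) simp
            qed (use xs in auto)
          next
            case False
            show ?thesis
            proof (rule block_forceable.step[of "x (Suc j1)" "x j3"])
              fix D2
              assume D2: "finite D2" "q \<le> real (card D2)"
                "\<forall>(l', r', D')\<in>set ((bs' @ [?B1]) @ [?B4]).
                  x (Suc j1) \<le> r' \<longrightarrow> l' \<le> x j3 \<longrightarrow> D2 \<inter> D' = {}"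
              let ?B2 = "(x (Suc j1), x j3, D2)"
              have D2E: "D2 \<inter> E = {}"
                using avoid[of "[?B1, ?B4]" "x (Suc j1)" "x j3" D2 j2] D2(3) C xs by (auto simp: E_def)
              have D21: "D2 \<inter> D1 = {}" using D2(3) xs by auto
              show "block_forceable q ?goal (((bs' @ [?B1]) @ [?B4]) @ [?B2])"
              proof (rule block_forceable.step[of "x j3" "x j4"])
                fix D3
                assume D3: "finite D3" "q \<le> real (card D3)"
                  "\<forall>(l', r', D')\<in>set (((bs' @ [?B1]) @ [?B4]) @ [?B2]).
                    x j3 \<le> r' \<longrightarrow> l' \<le> x j4 \<longrightarrow> D3 \<inter> D' = {}"
                let ?f = "[?B1, ?B4, ?B2, (x j3, x j4, D3)]"
                have D3E: "D3 \<inter> E = {}"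
                  using avoid[of "[?B1, ?B4, ?B2]" "x j3" "x j4" D3 j3] D3(3) C xs by (auto simp: E_def)
                have D3x: "D3 \<inter> D4 = {}" "D3 \<inter> D2 = {}" using D3(3) xs by auto
                \<comment> \<open>\<open>D2\<close> avoids \<open>D1\<close> and \<open>D3\<close>
                  avoids \<open>D4\<close>, so both avoid \<open>D1 \<inter> D4\<close>, which has
                  more than \<open>2 * q - 3 * q / 2\<close> elements. With \<open>D2\<close> and
                  \<open>D3\<close>, disjoint from each other, the gain is at least
                  \<open>5 * q / 2\<close>.\<close>
                have "card (E \<union> ((D1 \<inter> D4) \<union> (D2 \<union> D3))) =
                    card E + (card (D1 \<inter> D4) + (card D2 + card D3))"
                proof -
                  have "card (D2 \<union> D3) = card D2 + card D3"
                    using D2(1) D3(1) D3x by (intro card_Un_disjoint) auto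
                  then show ?thesis
                    using E D1(1) D2(1) D3(1) D1E D2E D3E D21 D3x
                    by (subst card_disjoint_Un3) auto
                qed
                moreover have "card (E \<union> ((D1 \<inter> D4) \<union> (D2 \<union> D3))) \<le> card (E \<union> cols ?f)"
                  using E(2) D1(1) D2(1) D3(1) D4(1) by (intro card_mono) auto
                moreover have "card (D1 \<union> D4) + card (D1 \<inter> D4) = card D1 + card D4"
                  using card_Un_Int[OF D1(1) D4(1)] by simp
                ultimately have "T' \<le> real (card (E \<union> cols ?f))"
                  using E D1(2) D2(2) D3(2) D4(2) False unfolding T' by linarith
                moreover have "\<forall>t\<in>set ?f. inside a b t"
                  using xs ends D1(1) D2(1) D3(1) D4(1) by (simp add: inside_def)
                moreover have "load ?f p \<le> 2" for p using xs by simp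
                moreover have "load ?f p \<le> 1" if "p \<notin> range x" for p
                proof -
                  have "p \<noteq> x (Suc j1)" "p \<noteq> x j3" "p \<noteq> x j4" using that by auto
                  with xs show ?thesis by simp
                qed
                ultimately have "?goal (bs' @ ?f)" by (intro finish) blast+
                then show "block_forceable q ?goal
                    ((((bs' @ [?B1]) @ [?B4]) @ [?B2]) @ [(x j3, x j4, D3)])"
                  by (intro block_forceable.stop) simp
              qed (use xs in auto)
            qed (use xs in auto)
          qed
        qed (use xs in auto)
      qed (use xs in auto)
    qed
  qed
  then show ?case by (simp add: T'_def)
qed

subsection \<open>Realising a block\<close>

text \<open>Each class is cut into pieces of \<open>k\<close> consecutive members. A class of size
  \<open>c\<close> needs at most \<open>c div k + 1\<close> pieces, and the floors add up to at most
  \<open>n div k\<close>.\<close>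

lemma chunk_coloring:
  fixes \<chi> :: "nat \<Rightarrow> nat"
  assumes "k \<ge> 1" and "\<And>i. i < n \<Longrightarrow> \<chi> i < K"
  obtains g :: "nat \<Rightarrow> nat" where "\<And>i. i < n \<Longrightarrow> g i < K + n div k"
    and "\<And>i i'. i < n \<Longrightarrow> i' < n \<Longrightarrow> g i = g i' \<Longrightarrow> \<chi> i = \<chi> i'"
    and "\<And>c. card {i. i < n \<and> g i = c} \<le> k"
proof -
  define cl where "cl \<gamma> = {i. i < n \<and> \<chi> i = \<gamma>}" for \<gamma>
  define rank where "rank i = card {j\<in>cl (\<chi> i). j < i}" for i
  \<comment> \<open>\<open>f i\<close> names the piece of \<open>i\<close>; an injection
    \<open>e\<close> will renumber these pairs as colors below \<open>K + n div k\<close>.\<close>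
  define f where "f i = (\<chi> i, rank i div k)" for i
  have fin_cl: "finite (cl \<gamma>)" for \<gamma> by (simp add: cl_def)
  have rank_less: "rank i < rank i'" if "i < n" "\<chi> i = \<chi> i'" "i < i'" for i i'
    unfolding rank_def using that fin_cl by (intro psubset_card_mono) (auto simp: cl_def)
  have rank_card: "rank i < card (cl (\<chi> i))" if "i < n" for i
    unfolding rank_def using that fin_cl by (intro psubset_card_mono) (auto simp: cl_def)
  let ?F = "Sigma {..<K} (\<lambda>\<gamma>. {..card (cl \<gamma>) div k})"
  have fF: "f ` {..<n} \<subseteq> ?F"
  proof (rule image_subsetI)
    fix i assume "i \<in> {..<n}"
    then have "\<chi> i < K" "rank i div k \<le> card (cl (\<chi> i)) div k"
      using assms(2) rank_card[of i] by (auto intro: div_le_mono)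
    then show "f i \<in> ?F" by (simp add: f_def)
  qed
  have "(\<Sum>\<gamma><K. card (cl \<gamma>)) = card (\<Union>\<gamma>\<in>{..<K}. cl \<gamma>)"
    using fin_cl by (subst card_UN_disjoint) (auto simp: cl_def)
  also have "\<dots> \<le> card {..<n}" by (intro card_mono) (auto simp: cl_def)
  finally have sum_cl: "(\<Sum>\<gamma><K. card (cl \<gamma>)) \<le> n" by simp
  have sum_div: "(\<Sum>\<gamma>\<in>A. card (cl \<gamma>) div k) \<le> (\<Sum>\<gamma>\<in>A. card (cl \<gamma>)) div k" if "finite A" for A
    using that
  proof induction
    case (insert a A)
    then show ?case
      using assms(1) by (simp add: div_add1_eq[of "card (cl a)"])
  qed simp
  have "card ?F = K + (\<Sum>\<gamma><K. card (cl \<gamma>) div k)"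
    by (simp add: sum_Suc)
  also have "\<dots> \<le> K + n div k"
    using sum_div[of "{..<K}"] div_le_mono[OF sum_cl, of k] by simp
  finally have "card (f ` {..<n}) \<le> card {..<K + n div k}"
    using card_mono[OF _ fF] by simp
  then obtain e where e: "e ` (f ` {..<n}) \<subseteq> {..<K + n div k}" "inj_on e (f ` {..<n})"
    using card_le_inj[of "f ` {..<n}" "{..<K + n div k}"] by auto
  define g where "g i = e (f i)" for i
  show ?thesis
  proof (rule that[of g])
    show "g i < K + n div k" if "i < n" for i
    proof -
      have "f i \<in> f ` {..<n}" using that by (intro imageI) simp
      then have "g i \<in> {..<K + n div k}" using e(1) unfolding g_def by blast
      then show ?thesis by simp
    qed
    have ef: "f i = f i'" if "i < n" "i' < n" "g i = g i'" for i i'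
      by (rule inj_onD[OF e(2)]) (use that in \<open>simp_all add: g_def\<close>)
    show "\<chi> i = \<chi> i'" if "i < n" "i' < n" "g i = g i'" for i i'
      using ef[OF that] by (simp add: f_def)
    show "card {i. i < n \<and> g i = c} \<le> k" for c
    proof (cases "\<exists>i<n. g i = c")
      case True
      then obtain i where i: "i < n" "g i = c" by blast
      let ?A = "{i. i < n \<and> g i = c}"
      have A: "f i' = f i" if "i' \<in> ?A" for i' by (rule ef) (use that i in auto)
      have A\<chi>: "\<chi> i' = \<chi> i" "rank i' div k = rank i div k" if "i' \<in> ?A" for i'
        using A[OF that] by (simp_all add: f_def)
      \<comment> \<open>Within one piece the ranks are distinct and lie among \<open>k\<close>
        consecutive numbers.\<close>
      have "inj_on rank ?A"
      proof (rule inj_onI)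
        fix a b assume ab: "a \<in> ?A" "b \<in> ?A" "rank a = rank b"
        have "\<chi> a = \<chi> b" using A\<chi>(1)[OF ab(1)] A\<chi>(1)[OF ab(2)] by simp
        then show "a = b"
          using rank_less[of a b] rank_less[of b a] ab by (cases a b rule: linorder_cases) auto
      qed
      moreover have "rank ` ?A \<subseteq> {rank i div k * k..<rank i div k * k + k}"
      proof (rule image_subsetI)
        fix i' assume "i' \<in> ?A"
        then have "rank i' div k = rank i div k" by (rule A\<chi>(2))
        then show "rank i' \<in> {rank i div k * k..<rank i div k * k + k}"
          using div_mult_mod_eq[of "rank i'" k] mod_less_divisor[of k "rank i'"] assms(1)
          by (simp only: atLeastLessThan_iff) linarith
      qed
      ultimately have "card ?A \<le> card {rank i div k * k..<rank i div k * k + k}"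
        by (rule card_inj_on_le) simp
      then show ?thesis by simp
    next
      case False
      then have "{i. i < n \<and> g i = c} = {}" by auto
      then show ?thesis by (simp only: card.empty)
    qed
  qed
qed

section \<open>The Halldorsson--Szegedy construction inside one bundle\<close>

text \<open>
  Item \<open>t\<close> of a block is given the set \<open>S\<close> of hidden classes it may join, and \<open>\<chi> j\<close> is the
  class of item \<open>j\<close>. The weight \<open>2 * d * \<delta>\<close> makes item \<open>t\<close> incompatible with every earlier
  item \<open>j\<close> whose class is not in \<open>S\<close>; up to \<open>d\<close> weights \<open>\<delta>\<close> are harmless within the block, but an
  item of any earlier block, all of whose weights exceed \<open>d * \<delta>\<close>, conflicts with coordinate \<open>t\<close>.
\<close>

definition hs_weight :: "nat \<Rightarrow> real \<Rightarrow> nat set \<Rightarrow> (nat \<Rightarrow> nat) \<Rightarrow> nat \<Rightarrow> nat \<Rightarrow> real" where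
  "hs_weight d \<delta> S \<chi> t = (\<lambda>j\<in>{..<d}. if j = t then 1 - real d * \<delta>
     else if j < t \<and> \<chi> j \<notin> S then 2 * real d * \<delta> else \<delta>)"

text \<open>The sets \<open>S i\<close> and the classes \<open>\<chi>\<close> are Presenter's
  private bookkeeping and no part of the history, hence the existential quantifier. Items of one
  on-line color never share a class, whereas off-line the classes themselves will serve as
  colors.\<close>

definition hs_state :: "nat \<Rightarrow> nat \<Rightarrow> real \<Rightarrow> real \<Rightarrow> real \<Rightarrow> history \<Rightarrow> bool" where
  "hs_state d s \<delta> l r B \<longleftrightarrow> (\<exists>S \<chi>. length B \<le> d \<and>
     (\<forall>i<length B. S i \<subseteq> {..<2 * s} \<and> card (S i) = s \<and> \<chi> i \<in> S i \<and>
        fst (B ! i) = WInterval l r (hs_weight d \<delta> (S i) \<chi> i)) \<and>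
     (\<forall>c. inj_on \<chi> {i. i < length B \<and> snd (B ! i) = c} \<and>
        card {i. i < length B \<and> snd (B ! i) = c} \<le> s))"

text \<open>The weight of item \<open>t\<close> reads only earlier classes, so the class of
  \<open>t\<close> can be chosen after Algorithm has colored it.\<close>

lemma hs_weight_cong:
  assumes "\<And>j. j < t \<Longrightarrow> \<chi> j = \<chi>' j"
  shows "hs_weight d \<delta> S \<chi> t = hs_weight d \<delta> S \<chi>' t"
  using assms by (auto simp: hs_weight_def fun_eq_iff restrict_def)

lemma hs_weight_bounds:
  assumes "\<delta> > 0" and "2 * (real d)\<^sup>2 * \<delta> \<le> 1" and "j < d"
  shows "0 < hs_weight d \<delta> S \<chi> t j" and "hs_weight d \<delta> S \<chi> t j \<le> 1"
proof -
  have "real d * 1 \<le> real d * real d" using assms(3) by (intro mult_left_mono) auto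
  then have "2 * real d * \<delta> \<le> 2 * (real d)\<^sup>2 * \<delta>"
    using assms(1) by (intro mult_right_mono) (auto simp: power2_eq_square)
  then have d: "2 * real d * \<delta> \<le> 1" using assms(2) by simp
  have "1 * \<delta> \<le> real d * \<delta>" using assms by (intro mult_right_mono) auto
  with d assms(1) have "\<delta> \<le> 1" by linarith
  then show "0 < hs_weight d \<delta> S \<chi> t j" "hs_weight d \<delta> S \<chi> t j \<le> 1"
    using assms d by (auto simp: hs_weight_def)
qed

lemma is_winterval_hs_weight:
  assumes "\<delta> > 0" and "2 * (real d)\<^sup>2 * \<delta> \<le> 1" and "l \<le> r"
  shows "is_winterval d (WInterval l r (hs_weight d \<delta> S \<chi> t))"
proof -
  have "hs_weight d \<delta> S \<chi> t \<in> extensional {..<d}" by (simp add: hs_weight_def)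
  then show ?thesis
    using hs_weight_bounds[OF assms(1,2)] assms(3)
    by (auto simp: is_winterval_def PiE_def less_imp_le)
qed

text \<open>Every color is used on at most \<open>s\<close> items, so a bundle that has reached
  \<open>d\<close> items has reached the target of \<open>d / s\<close> colors.\<close>

lemma hs_state_full:
  assumes "hs_state d s \<delta> l r B"
  shows "length B \<le> s * card (snd ` set B)"
proof -
  let ?I = "\<lambda>c. {i. i < length B \<and> snd (B ! i) = c}"
  have "snd (B ! i) \<in> snd ` set B" if "i < length B" for i
    using that by (intro imageI nth_mem)
  then have "{..<length B} = (\<Union>c\<in>snd ` set B. ?I c)" by blast
  then have "length B = card (\<Union>c\<in>snd ` set B. ?I c)" by (metis card_lessThan)
  also have "\<dots> \<le> (\<Sum>c\<in>snd ` set B. card (?I c))" by (intro card_UN_le) simp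
  also have "\<dots> \<le> (\<Sum>c\<in>snd ` set B. s)"
    using assms by (intro sum_mono) (auto simp: hs_state_def)
  finally show ?thesis by (simp add: mult.commute)
qed

text \<open>There are more \<open>s\<close>-subsets of the classes than colors in use, so some
  \<open>S\<close> is the class set of no color. The premise on \<open>c\<close> is the part of
  validity that rules out colors holding a class outside \<open>S\<close>.\<close>

lemma hs_state_step:
  assumes B: "hs_state d s \<delta> l r B" and len: "length B < d" and s: "s \<ge> 1"
    and few: "card (snd ` set B) < (2 * s) choose s"
    and \<delta>: "\<delta> > 0" "2 * (real d)\<^sup>2 * \<delta> \<le> 1"
  obtains S \<chi> where
    "\<And>c. (\<And>i. i < length B \<Longrightarrow> snd (B ! i) = c \<Longrightarrow>
        weight (fst (B ! i)) i + hs_weight d \<delta> S \<chi> (length B) i \<le> 1) \<Longrightarrow>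
      hs_state d s \<delta> l r (B @ [(WInterval l r (hs_weight d \<delta> S \<chi> (length B)), c)])"
proof -
  define t where "t = length B"
  obtain R \<chi> where R: "\<And>i. i < t \<Longrightarrow> R i \<subseteq> {..<2 * s} \<and> card (R i) = s \<and> \<chi> i \<in> R i \<and>
        fst (B ! i) = WInterval l r (hs_weight d \<delta> (R i) \<chi> i)"
     and col: "\<And>c. inj_on \<chi> {i. i < t \<and> snd (B ! i) = c}"
       "\<And>c. card {i. i < t \<and> snd (B ! i) = c} \<le> s"
    using B unfolding hs_state_def t_def by blast
  define H where "H c = \<chi> ` {i. i < t \<and> snd (B ! i) = c}" for c
  let ?N = "{S. S \<subseteq> {..<2 * s} \<and> card S = s}"
  have "\<not> ?N \<subseteq> H ` snd ` set B"
  proof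
    assume "?N \<subseteq> H ` snd ` set B"
    then have "card ?N \<le> card (H ` snd ` set B)" by (intro card_mono) auto
    also have "\<dots> \<le> card (snd ` set B)" by (intro card_image_le) auto
    finally show False using few n_subsets[of "{..<2 * s}" s] by simp
  qed
  then obtain S where S: "S \<subseteq> {..<2 * s}" "card S = s" "S \<notin> H ` snd ` set B" by auto
  have finS: "finite S" using S(1) finite_subset by blast
  show ?thesis
  proof (rule that[of S \<chi>])
    fix c
    assume valid: "\<And>i. i < length B \<Longrightarrow> snd (B ! i) = c \<Longrightarrow>
        weight (fst (B ! i)) i + hs_weight d \<delta> S \<chi> (length B) i \<le> 1"
    have "\<chi> i \<in> S" if i: "i < t" "snd (B ! i) = c" for i
    proof (rule ccontr)
      assume "\<chi> i \<notin> S"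
      \<comment> \<open>Coordinate \<open>i\<close> would carry \<open>1 - d * \<delta>\<close> from
        item \<open>i\<close> and \<open>2 * d * \<delta>\<close> from the new item.\<close>
      then have "1 - real d * \<delta> + 2 * real d * \<delta> \<le> 1"
        using valid[of i] i R[of i] len by (simp add: t_def hs_weight_def)
      then have "real d * \<delta> \<le> 0" by linarith
      then show False using \<delta>(1) len by (simp add: mult_le_0_iff)
    qed
    then have HS: "H c \<subseteq> S" by (auto simp: H_def)
    moreover have "H c \<noteq> S"
    proof (cases "c \<in> snd ` set B")
      case True
      then show ?thesis using S by auto
    next
      \<comment> \<open>A color not yet used has the empty class set, which differs from
        \<open>S\<close> because \<open>s \<ge> 1\<close>.\<close>
      case False
      then have "{i. i < t \<and> snd (B ! i) = c} = {}" by (auto simp: t_def)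
      then have "H c = {}" by (simp only: H_def image_empty)
      then show ?thesis using S(2) s by auto
    qed
    ultimately obtain y where y: "y \<in> S" "y \<notin> H c" by blast
    \<comment> \<open>As \<open>S\<close> was chosen different from the class set of every color, the class set of the
      color \<open>c\<close> can be made to grow inside \<open>S\<close>, so no color is ever used more than \<open>s\<close> times.\<close>
    define \<chi>' where "\<chi>' = \<chi>(t := y)"
    define R' where "R' = R(t := S)"
    let ?B' = "B @ [(WInterval l r (hs_weight d \<delta> S \<chi> (length B)), c)]"
    have w: "hs_weight d \<delta> P \<chi>' i = hs_weight d \<delta> P \<chi> i" if "i \<le> t" for P i
      using that by (intro hs_weight_cong) (auto simp: \<chi>'_def)
    have items: "R' i \<subseteq> {..<2 * s} \<and> card (R' i) = s \<and> \<chi>' i \<in> R' i \<and>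
        fst (?B' ! i) = WInterval l r (hs_weight d \<delta> (R' i) \<chi>' i)" if "i < length ?B'" for i
    proof (cases "i = t")
      case True
      then show ?thesis using S y w[of t] by (simp add: R'_def \<chi>'_def t_def)
    next
      case False
      then have "i < t" using that by (simp add: t_def)
      then show ?thesis
        using R[of i] w[of i] by (simp add: R'_def \<chi>'_def nth_append t_def[symmetric])
    qed
    have cls: "inj_on \<chi>' {i. i < length ?B' \<and> snd (?B' ! i) = c'} \<and>
      card {i. i < length ?B' \<and> snd (?B' ! i) = c'} \<le> s" for c'
    proof -
      have \<chi>'_old: "\<chi>' ` {i. i < t \<and> snd (B ! i) = c'} = H c'"
        by (auto simp: \<chi>'_def H_def image_def)
      have inj_old: "inj_on \<chi>' {i. i < t \<and> snd (B ! i) = c'}"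
        using col(1)[of c'] by (auto simp: \<chi>'_def inj_on_def)
      show ?thesis
      proof (cases "c' = c")
        case False
        then have "{i. i < length ?B' \<and> snd (?B' ! i) = c'} = {i. i < t \<and> snd (B ! i) = c'}"
          by (auto simp: t_def nth_append less_Suc_eq)
        then show ?thesis using inj_old col(2)[of c'] by simp
      next
        case True
        then have eq: "{i. i < length ?B' \<and> snd (?B' ! i) = c'} =
            insert t {i. i < t \<and> snd (B ! i) = c'}"
          by (auto simp: t_def nth_append less_Suc_eq)
        have inj: "inj_on \<chi>' (insert t {i. i < t \<and> snd (B ! i) = c'})"
          using inj_old y \<chi>'_old True by (subst inj_on_insert) (auto simp: \<chi>'_def)
        have "card (insert t {i. i < t \<and> snd (B ! i) = c'}) =
            card (\<chi>' ` insert t {i. i < t \<and> snd (B ! i) = c'})"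
          using card_image[OF inj] by simp
        also have "\<dots> = card (insert y (H c))"
          by (simp only: image_insert \<chi>'_old) (simp add: \<chi>'_def True)
        also have "\<dots> \<le> s"
          using card_mono[OF finS, of "insert y (H c)"] HS y S by simp
        finally show ?thesis using inj unfolding eq by blast
      qed
    qed
    show "hs_state d s \<delta> l r ?B'"
      unfolding hs_state_def
      by (rule exI[of _ R'], rule exI[of _ \<chi>'], intro conjI allI impI)
        (use items cls len in auto)
  qed
qed

text \<open>Items of one class are compatible. If item \<open>j\<close> is among them, every other
  item has \<open>\<chi> j\<close> in its own set, thus weight \<open>\<delta>\<close> in coordinate
  \<open>j\<close>, and these fit into the slack \<open>d * \<delta>\<close>. If it is not, at most
  \<open>d\<close> weights of at most \<open>2 * d * \<delta>\<close> remain. Cutting the classes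
  into pieces takes care of \<open>k\<close>.\<close>

lemma hs_state_offline:
  assumes B: "hs_state d s \<delta> l r B" and k: "k \<ge> 1"
    and \<delta>: "\<delta> > 0" "2 * (real d)\<^sup>2 * \<delta> \<le> 1"
  shows "\<exists>g. kd_coloring k d (map fst B) g \<and> (\<forall>i<length B. g i < 2 * s + d div k)"
proof -
  define n where "n = length B"
  obtain S \<chi> where n: "n \<le> d" and S: "\<And>i. i < n \<Longrightarrow> S i \<subseteq> {..<2 * s} \<and> card (S i) = s \<and> \<chi> i \<in> S i \<and>
        fst (B ! i) = WInterval l r (hs_weight d \<delta> (S i) \<chi> i)"
    using B unfolding hs_state_def n_def by blast
  have "\<chi> i < 2 * s" if "i < n" for i using S[OF that] by auto
  then obtain g where g: "\<And>i. i < n \<Longrightarrow> g i < 2 * s + n div k"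
    "\<And>i i'. i < n \<Longrightarrow> i' < n \<Longrightarrow> g i = g i' \<Longrightarrow> \<chi> i = \<chi> i'"
    "\<And>c. card {i. i < n \<and> g i = c} \<le> k"
    using chunk_coloring[OF k, of n \<chi> "2 * s"] by blast
  have "kd_coloring k d (map fst B) g"
    unfolding kd_coloring_def
  proof (intro allI conjI impI)
    fix \<gamma> p
    let ?A = "at_point (map fst B) g \<gamma> p"
    have A: "?A \<subseteq> {i. i < n \<and> g i = \<gamma>}" by (auto simp: at_point_def n_def)
    show "card ?A \<le> k"
      by (rule le_trans[OF card_mono[OF _ A] g(3)]) simp
    have finA: "finite ?A" using A finite_subset by fastforce
    have cardA: "card ?A \<le> d" using card_mono[of "{..<n}" ?A] A n by fastforce
    fix j assume j: "j < d"
    have wt: "weight (map fst B ! i) j = hs_weight d \<delta> (S i) \<chi> i j" if "i \<in> ?A" for i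
      using that A S[of i] by (auto simp: n_def)
    show "(\<Sum>i\<in>?A. weight (map fst B ! i) j) \<le> 1"
    proof (cases "j \<in> ?A")
      case True
      have "weight (map fst B ! i) j = \<delta>" if i: "i \<in> ?A" "i \<noteq> j" for i
      proof -
        have "\<chi> j = \<chi> i" using g(2)[of j i] i True A by auto
        then have "\<chi> j \<in> S i" using S[of i] i A by auto
        then show ?thesis using wt[OF i(1)] i(2) j by (simp add: hs_weight_def)
      qed
      then have "(\<Sum>i\<in>?A - {j}. weight (map fst B ! i) j) = real (card (?A - {j})) * \<delta>"
        by simp
      also have "\<dots> \<le> real d * \<delta>"
        using cardA finA \<delta>(1) by (intro mult_right_mono) (auto simp: card_Diff_singleton_if)
      finally have "(\<Sum>i\<in>?A - {j}. weight (map fst B ! i) j) \<le> real d * \<delta>" .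
      moreover have "weight (map fst B ! j) j = 1 - real d * \<delta>"
        using wt[OF True] j by (simp add: hs_weight_def)
      ultimately show ?thesis using sum.remove[OF finA True, of "\<lambda>i. weight (map fst B ! i) j"] by simp
    next
      case False
      have "(\<Sum>i\<in>?A. weight (map fst B ! i) j) \<le> (\<Sum>i\<in>?A. 2 * real d * \<delta>)"
      proof (rule sum_mono)
        fix i assume i: "i \<in> ?A"
        have "1 * \<delta> \<le> 2 * real d * \<delta>" using j \<delta>(1) by (intro mult_right_mono) auto
        then show "weight (map fst B ! i) j \<le> 2 * real d * \<delta>"
          using wt[OF i] i False j by (auto simp: hs_weight_def)
      qed
      also have "\<dots> = real (card ?A) * (2 * real d * \<delta>)" by simp
      also have "\<dots> \<le> real d * (2 * real d * \<delta>)"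
        using cardA \<delta>(1) by (intro mult_right_mono) auto
      also have "\<dots> \<le> 1" using \<delta>(2) by (simp add: power2_eq_square mult_ac)
      finally show ?thesis .
    qed
  qed
  moreover have "g i < 2 * s + d div k" if "i < n" for i
    using g(1)[OF that] div_le_mono[OF n, of k] by simp
  ultimately show ?thesis by (auto simp: n_def)
qed

lemma valid_pair:
  assumes v: "valid k d h" and i: "i < length h" "i' < length h" "i \<noteq> i'" "snd (h ! i) = snd (h ! i')"
    and p: "p \<in> points (fst (h ! i))" "p \<in> points (fst (h ! i'))" and j: "j < d"
    and nonneg: "\<And>y. y \<in> set h \<Longrightarrow> 0 \<le> weight (fst y) j"
  shows "weight (fst (h ! i)) j + weight (fst (h ! i')) j \<le> 1"
proof -
  let ?A = "at_point (intervals h) (color_of h) (snd (h ! i)) p"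
  have "finite ?A" by (simp add: at_point_def)
  moreover have "{i, i'} \<subseteq> ?A"
    using i p by (auto simp: at_point_def intervals_def color_of_def)
  ultimately have "(\<Sum>a\<in>{i, i'}. weight (intervals h ! a) j) \<le> (\<Sum>a\<in>?A. weight (intervals h ! a) j)"
    using nonneg by (intro sum_mono2) (auto simp: at_point_def intervals_def)
  also have "\<dots> \<le> 1" using v j by (auto simp: valid_def kd_coloring_def)
  finally show ?thesis using i by (simp add: intervals_def)
qed

lemma hs_state_weights:
  assumes "hs_state d s \<delta> l r B" and "\<delta> > 0" and "2 * (real d)\<^sup>2 * \<delta> \<le> 1"
    and "y \<in> set B"
  shows "left_end (fst y) = l" "right_end (fst y) = r" "j < d \<Longrightarrow> 0 < weight (fst y) j"
proof -
  obtain i where "i < length B" "B ! i = y" using assms(4) by (auto simp: in_set_conv_nth)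
  then obtain S \<chi> where "fst y = WInterval l r (hs_weight d \<delta> S \<chi> i)"
    using assms(1) unfolding hs_state_def by metis
  then show "left_end (fst y) = l" "right_end (fst y) = r" "j < d \<Longrightarrow> 0 < weight (fst y) j"
    using hs_weight_bounds(1)[OF assms(2,3)] by auto
qed

definition fresh_block :: "history \<Rightarrow> real \<Rightarrow> real \<Rightarrow> history \<Rightarrow> bool" where
  "fresh_block h l r B \<longleftrightarrow>
     (\<forall>(v, c)\<in>set h. left_end v \<le> r \<longrightarrow> l \<le> right_end v \<longrightarrow> c \<notin> snd ` set B)"

text \<open>As long as the target is missed, the bundle has fewer than \<open>d\<close> items and,
  by \<open>ds\<close>, fewer than \<open>(2 * s) choose s\<close> colors, which is what
  \<open>hs_state_step\<close> needs for one more item.\<close>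

lemma force_hs_block:
  assumes s: "s \<ge> 1" and ds: "d \<le> s * ((2 * s) choose s)" and lr: "l \<le> r"
    and \<delta>: "\<delta> > 0" "2 * (real d)\<^sup>2 * \<delta> \<le> 1"
    and h: "\<And>y. y \<in> set h \<Longrightarrow> left_end (fst y) \<le> right_end (fst y)"
      "\<And>y j. y \<in> set h \<Longrightarrow> j < d \<Longrightarrow> real d * \<delta> < weight (fst y) j"
    and "hs_state d s \<delta> l r B" and "fresh_block h l r B"
  shows "forceable k d (\<lambda>h'. \<exists>B. h' = h @ B \<and> hs_state d s \<delta> l r B \<and> fresh_block h l r B \<and>
    d \<le> s * card (snd ` set B)) (h @ B)"
  using assms(8,9)
proof (induction "d - length B" arbitrary: B rule: less_induct)
  case less
  show ?case
  proof (cases "d \<le> s * card (snd ` set B)")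
    case True
    then show ?thesis using less.prems by (intro forceable.stop) auto
  next
    case False
    then have len: "length B < d" using hs_state_full[OF less.prems(1)] by simp
    have "card (snd ` set B) < (2 * s) choose s"
    proof (rule ccontr)
      assume "\<not> ?thesis"
      then have "s * ((2 * s) choose s) \<le> s * card (snd ` set B)" by simp
      with ds False show False by linarith
    qed
    then obtain S \<chi> where S: "\<And>c. (\<And>i. i < length B \<Longrightarrow> snd (B ! i) = c \<Longrightarrow>
        weight (fst (B ! i)) i + hs_weight d \<delta> S \<chi> (length B) i \<le> 1) \<Longrightarrow>
      hs_state d s \<delta> l r (B @ [(WInterval l r (hs_weight d \<delta> S \<chi> (length B)), c)])"
      using hs_state_step[OF less.prems(1) len s _ \<delta>] by blast
    define v where "v = WInterval l r (hs_weight d \<delta> S \<chi> (length B))"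
    show ?thesis
    proof (rule forceable.step)
      show v: "is_winterval d v" unfolding v_def by (rule is_winterval_hs_weight) fact+
      fix c assume valid: "valid k d ((h @ B) @ [(v, c)])"
      let ?h = "(h @ B) @ [(v, c)]"
      have nonneg: "0 \<le> weight (fst y) j" if "y \<in> set ?h" "j < d" for y j
      proof -
        have "0 < weight v j"
          using hs_weight_bounds(1)[OF \<delta> that(2)] by (simp add: v_def)
        moreover have "0 < weight (fst y) j" if "y \<in> set h"
        proof -
          have "0 \<le> real d * \<delta>" using \<delta>(1) by simp
          with h(2)[OF that \<open>j < d\<close>] show ?thesis by linarith
        qed
        moreover have "0 < weight (fst y) j" if "y \<in> set B"
          using hs_state_weights(3)[OF less.prems(1) \<delta> that \<open>j < d\<close>] .
        ultimately show ?thesis using that(1) by fastforce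
      qed
      have vh: "?h ! (length h + length B) = (v, c)" by (simp add: nth_append)
      have "hs_state d s \<delta> l r (B @ [(v, c)])"
        unfolding v_def
      proof (rule S)
        fix i assume i: "i < length B" "snd (B ! i) = c"
        have Bi: "?h ! (length h + i) = B ! i" using i by (simp add: nth_append)
        have "l \<in> points (fst (B ! i))"
          using hs_state_weights(1,2)[OF less.prems(1) \<delta>, of "B ! i"] i lr by (simp add: points_def)
        moreover have "l \<in> points v" using lr by (simp add: points_def v_def)
        ultimately have "weight (fst (B ! i)) i + weight v i \<le> 1"
          using valid_pair[OF valid, of "length h + i" "length h + length B" l i] nonneg[of _ i] i len
          unfolding Bi vh by auto
        then show "weight (fst (B ! i)) i + hs_weight d \<delta> S \<chi> (length B) i \<le> 1"
          by (simp add: v_def)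
      qed
      moreover have "c' \<notin> snd ` set (B @ [(v, c)])"
        if y: "(v', c') \<in> set h" "left_end v' \<le> r" "l \<le> right_end v'" for v' c'
      proof
        assume c': "c' \<in> snd ` set (B @ [(v, c)])"
        have "c' \<notin> snd ` set B" using less.prems(2) y by (auto simp: fresh_block_def)
        with c' have "c' = c" by auto
        obtain i where i: "i < length h" "h ! i = (v', c')"
          using y(1) by (auto simp: in_set_conv_nth)
        have hi: "?h ! i = (v', c')" using i by (simp add: nth_append)
        \<comment> \<open>Intersecting intervals share the larger of their left ends. There
          coordinate \<open>length B\<close> would get \<open>1 - d * \<delta>\<close> from the new
          item and more than \<open>d * \<delta>\<close> from the old interval.\<close>
        have "max l (left_end v') \<in> points v'" "max l (left_end v') \<in> points v"
          using y lr h(1)[OF y(1)] by (auto simp: points_def v_def)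
        then have "weight v' (length B) + weight v (length B) \<le> 1"
          using valid_pair[OF valid, of i "length h + length B" "max l (left_end v')" "length B"]
            nonneg[of _ "length B"] i len \<open>c' = c\<close> unfolding hi vh by auto
        moreover have "weight v (length B) = 1 - real d * \<delta>"
          using len by (simp add: v_def hs_weight_def)
        ultimately show False using h(2)[OF y(1) len] by simp
      qed
      then have "fresh_block h l r (B @ [(v, c)])" unfolding fresh_block_def by blast
      moreover have "d - length (B @ [(v, c)]) < d - length B" using len by simp
      ultimately have "forceable k d (\<lambda>h'. \<exists>B. h' = h @ B \<and> hs_state d s \<delta> l r B \<and> fresh_block h l r B \<and>
        d \<le> s * card (snd ` set B)) (h @ (B @ [(v, c)]))"
        by (intro less.hyps)
      then show "forceable k d (\<lambda>h'. \<exists>B. h' = h @ B \<and> hs_state d s \<delta> l r B \<and> fresh_block h l r B \<and>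
        d \<le> s * card (snd ` set B)) ?h" by simp
    qed
  qed
qed

subsection \<open>Off-line colorings\<close>

text \<open>Greedy choice by increasing left ends: the earlier intervals that meet the new one all
  contain its left end, so together with it they number at most \<open>m\<close>, and one palette is
  free.\<close>

lemma interval_palettes:
  fixes L R :: "'a \<Rightarrow> real"
  assumes "finite I" and "\<And>i. i \<in> I \<Longrightarrow> L i \<le> R i"
    and "\<And>p. card {i \<in> I. L i \<le> p \<and> p \<le> R i} \<le> m"
  shows "\<exists>\<pi>. (\<forall>i\<in>I. \<pi> i < m) \<and>
    (\<forall>i\<in>I. \<forall>j\<in>I. i \<noteq> j \<longrightarrow> L i \<le> R j \<longrightarrow> L j \<le> R i \<longrightarrow> \<pi> i \<noteq> (\<pi> j :: nat))"
  using assms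
proof (induction I rule: finite_ranking_induct[where f = L])
  case (insert x I)
  show ?case
  proof (cases "x \<in> I")
    case True
    then show ?thesis using insert by (simp add: insert_absorb)
  next
    case False
    have "card {i \<in> I. L i \<le> p \<and> p \<le> R i} \<le> m" for p
      using insert.hyps(1) by (intro le_trans[OF card_mono insert.prems(2)[of p]]) auto
    then obtain \<pi> where \<pi>: "\<forall>i\<in>I. \<pi> i < m"
      "\<forall>i\<in>I. \<forall>j\<in>I. i \<noteq> j \<longrightarrow> L i \<le> R j \<longrightarrow> L j \<le> R i \<longrightarrow> \<pi> i \<noteq> \<pi> j"
      using insert.IH insert.prems(1) by blast
    let ?N = "{i \<in> I. L x \<le> R i}"
    have "insert x ?N \<subseteq> {i \<in> insert x I. L i \<le> L x \<and> L x \<le> R i}"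
      using insert.hyps(2) insert.prems(1) by auto
    then have "card (insert x ?N) \<le> m"
      using insert.hyps(1) by (intro le_trans[OF card_mono insert.prems(2)[of "L x"]]) auto
    then have "card ?N < m" using insert.hyps(1) False by simp
    moreover have "card (\<pi> ` ?N) \<le> card ?N" using insert.hyps(1) by (intro card_image_le) auto
    ultimately have "\<not> {..<m} \<subseteq> \<pi> ` ?N"
      using card_mono[of "\<pi> ` ?N" "{..<m}"] insert.hyps(1) by auto
    then obtain c where c: "c < m" "c \<notin> \<pi> ` ?N" by auto
    show ?thesis
      by (rule exI[of _ "\<pi>(x := c)"]) (use \<pi> c False in auto)
  qed
qed simp

text \<open>This ties a bundle of the real game to its abstract block. Positive weights are recorded
  because later bundles choose their \<open>\<delta>\<close> below them; \<open>g\<close> colors the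
  bundle off-line within one palette of \<open>X\<close> colors.\<close>

definition good_block :: "nat \<Rightarrow> nat \<Rightarrow> nat \<Rightarrow> history \<Rightarrow> block \<Rightarrow> bool" where
  "good_block k d X B = (\<lambda>(l, r, D). l \<le> r \<and> D = snd ` set B \<and>
     (\<forall>y\<in>set B. left_end (fst y) = l \<and> right_end (fst y) = r \<and> (\<forall>j<d. 0 < weight (fst y) j)) \<and>
     (\<exists>g. kd_coloring k d (map fst B) g \<and> (\<forall>i<length B. g i < X)))"

text \<open>The number \<open>a * X + g i\<close> encodes color \<open>g i\<close> of palette
  \<open>a\<close>. Old intervals meeting new ones use other palettes, so at no point does a color
  mix old and new intervals.\<close>

lemma kd_coloring_append:
  assumes vs: "kd_coloring k d vs f" and ws: "kd_coloring k d ws g"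
    and X: "\<And>i. i < length ws \<Longrightarrow> g i < X"
    and sep: "\<And>i i' p. i < length vs \<Longrightarrow> i' < length ws \<Longrightarrow> p \<in> points (vs ! i) \<Longrightarrow>
      p \<in> points (ws ! i') \<Longrightarrow> f i div X \<noteq> a"
  shows "kd_coloring k d (vs @ ws) (\<lambda>i. if i < length vs then f i else a * X + g (i - length vs))"
    (is "kd_coloring k d _ ?h")
proof -
  let ?n = "length vs"
  have div: "(a * X + g i) div X = a" "(a * X + g i) mod X = g i" if "i < length ws" for i
    using X[OF that] by auto
  have "card (at_point (vs @ ws) ?h \<gamma> p) \<le> k \<and>
      (\<forall>j<d. (\<Sum>i\<in>at_point (vs @ ws) ?h \<gamma> p. weight ((vs @ ws) ! i) j) \<le> 1)" for \<gamma> p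
  proof (cases "\<exists>i<length ws. p \<in> points (ws ! i) \<and> a * X + g i = \<gamma>")
    case True
    then obtain i0 where i0: "i0 < length ws" "p \<in> points (ws ! i0)" "a * X + g i0 = \<gamma>" by blast
    have \<gamma>: "\<gamma> div X = a" "a * X + g i = \<gamma> \<longleftrightarrow> g i = g i0" for i using div[OF i0(1)] i0(3) by auto
    have "at_point (vs @ ws) ?h \<gamma> p = (\<lambda>i. ?n + i) ` at_point ws g (g i0) p" (is "?A = ?B")
    proof (intro set_eqI iffI)
      fix i assume i: "i \<in> ?A"
      have "\<not> i < ?n"
      proof
        assume "i < ?n"
        then show False using i sep[of i i0 p] i0 \<gamma>(1) by (auto simp: at_point_def nth_append)
      qed
      then show "i \<in> ?B"
        using i \<gamma>(2) by (intro image_eqI[of _ _ "i - ?n"]) (auto simp: at_point_def nth_append)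
    next
      fix i assume "i \<in> ?B"
      then obtain i' where "i = ?n + i'" "i' < length ws" "p \<in> points (ws ! i')" "g i' = g i0"
        by (auto simp: at_point_def)
      then show "i \<in> ?A" using i0(3) by (simp add: at_point_def nth_append)
    qed
    then show ?thesis
      using ws by (simp add: card_image sum.reindex kd_coloring_def)
  next
    case False
    have "at_point (vs @ ws) ?h \<gamma> p = at_point vs f \<gamma> p" (is "?A = ?B")
    proof (intro set_eqI iffI)
      fix i assume i: "i \<in> ?A"
      have "i < ?n"
      proof (rule ccontr)
        assume "\<not> i < ?n"
        then have "i - ?n < length ws" "p \<in> points (ws ! (i - ?n))" "a * X + g (i - ?n) = \<gamma>"
          using i by (auto simp: at_point_def nth_append)
        with False show False by blast
      qed
      then show "i \<in> ?B" using i by (auto simp: at_point_def nth_append)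
    next
      fix i assume "i \<in> ?B"
      then show "i \<in> ?A" by (auto simp: at_point_def nth_append)
    qed
    moreover have "(\<Sum>i\<in>at_point vs f \<gamma> p. weight ((vs @ ws) ! i) j) =
        (\<Sum>i\<in>at_point vs f \<gamma> p. weight (vs ! i) j)" for j
      by (intro sum.cong) (auto simp: at_point_def nth_append)
    ultimately show ?thesis using vs by (simp add: kd_coloring_def)
  qed
  then show ?thesis by (auto simp: kd_coloring_def)
qed

text \<open>Bundles with a common point get disjoint palettes. The conclusion also records the
  palette \<open>col i div X\<close> and the extent of each interval, which the induction needs for
  appending the next bundle.\<close>

lemma blocks_offline:
  assumes "list_all2 (good_block k d X) Bs bs"
    and "\<And>b. b < length bs \<Longrightarrow> \<pi> b < m"
    and "\<And>b b'. b < length bs \<Longrightarrow> b' < length bs \<Longrightarrow> b \<noteq> b' \<Longrightarrow>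
      fst (bs ! b) \<le> fst (snd (bs ! b')) \<Longrightarrow> fst (bs ! b') \<le> fst (snd (bs ! b)) \<Longrightarrow> \<pi> b \<noteq> \<pi> b'"
  shows "\<exists>col. kd_coloring k d (intervals (concat Bs)) col \<and>
    (\<forall>i<length (concat Bs). \<exists>b<length bs. col i div X = \<pi> b \<and> col i < m * X \<and>
      points (intervals (concat Bs) ! i) = {fst (bs ! b)..fst (snd (bs ! b))})"
  using assms
proof (induction Bs arbitrary: bs rule: rev_induct)
  case Nil
  then show ?case by (auto simp: kd_coloring_def at_point_def intervals_def)
next
  case (snoc B Bs)
  from snoc.prems(1) obtain cs t where bs: "bs = cs @ [t]" and all: "list_all2 (good_block k d X) Bs cs"
    and B: "good_block k d X B t"
    by (auto simp: list_all2_append1 list_all2_Cons1)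
  obtain l r D where t: "t = (l, r, D)" by (cases t)
  let ?vs = "intervals (concat Bs)" and ?ws = "map fst B" and ?n = "length cs"
  obtain col where col: "kd_coloring k d ?vs col"
    "\<And>i. i < length (concat Bs) \<Longrightarrow> \<exists>b<?n. col i div X = \<pi> b \<and> col i < m * X \<and>
      points (?vs ! i) = {fst (cs ! b)..fst (snd (cs ! b))}"
  proof -
    have "\<pi> b < m" if "b < length cs" for b using snoc.prems(2)[of b] that bs by simp
    moreover have "\<pi> b \<noteq> \<pi> b'" if "b < length cs" "b' < length cs" "b \<noteq> b'"
      "fst (cs ! b) \<le> fst (snd (cs ! b'))" "fst (cs ! b') \<le> fst (snd (cs ! b))" for b b'
      using snoc.prems(3)[of b b'] that bs by (simp add: nth_append)
    ultimately show ?thesis using snoc.IH[OF all] that by blast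
  qed
  obtain g where g: "kd_coloring k d ?ws g" "\<And>i. i < length B \<Longrightarrow> g i < X"
    using B by (auto simp: good_block_def t)
  have ptB: "points (?ws ! i) = {l..r}" if "i < length B" for i
    using B that nth_mem[OF that] by (auto simp: good_block_def t points_def)
  have bn: "bs ! ?n = (l, r, D)" by (simp add: bs t)
  have bb: "bs ! b = cs ! b" if "b < ?n" for b using that by (simp add: bs nth_append)
  let ?h = "\<lambda>i. if i < length ?vs then col i else \<pi> ?n * X + g (i - length ?vs)"
  have "kd_coloring k d (?vs @ ?ws) ?h"
  proof (rule kd_coloring_append[OF col(1) g(1)])
    fix i i' p assume *: "i < length ?vs" "i' < length ?ws" "p \<in> points (?vs ! i)" "p \<in> points (?ws ! i')"
    obtain b where b: "b < ?n" "col i div X = \<pi> b" "points (?vs ! i) = {fst (cs ! b)..fst (snd (cs ! b))}"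
      using col(2)[of i] * by (auto simp: intervals_def)
    have "\<pi> b \<noteq> \<pi> ?n"
      using * b ptB[of i'] bn bb[OF b(1)] by (intro snoc.prems(3)) (auto simp: bs)
    then show "col i div X \<noteq> \<pi> ?n" using b by simp
  qed (use g in auto)
  moreover have "\<exists>b<length bs. ?h i div X = \<pi> b \<and> ?h i < m * X \<and>
      points ((?vs @ ?ws) ! i) = {fst (bs ! b)..fst (snd (bs ! b))}"
    if i: "i < length (concat (Bs @ [B]))" for i
  proof (cases "i < length ?vs")
    case True
    then obtain b where "b < ?n" "col i div X = \<pi> b" "col i < m * X"
      "points (?vs ! i) = {fst (cs ! b)..fst (snd (cs ! b))}"
      using col(2)[of i] by (auto simp: intervals_def)
    then show ?thesis
      using True bb[of b] by (intro exI[of _ b]) (auto simp: nth_append bs)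
  next
    case False
    then have i': "i - length ?vs < length B" using i by (auto simp: intervals_def)
    have "\<pi> ?n + 1 \<le> m" using snoc.prems(2)[of ?n] by (simp add: bs)
    then have "(\<pi> ?n + 1) * X \<le> m * X" by (rule mult_le_mono1)
    then have "\<pi> ?n * X + g (i - length ?vs) < m * X" using g(2)[OF i'] by simp
    then show ?thesis
      using False i' g(2)[OF i'] ptB[OF i'] bn
      by (intro exI[of _ ?n]) (auto simp: nth_append bs)
  qed
  ultimately show ?case
    by (intro exI[of _ ?h]) (auto simp: intervals_def)
qed

lemma blocks_colorable:
  assumes Bs: "list_all2 (good_block k d X) Bs bs" and load: "\<And>p. load bs p \<le> m"
  shows "colorable k d (real (m * X)) (intervals (concat Bs))"
proof -
  let ?L = "\<lambda>b. fst (bs ! b)" and ?R = "\<lambda>b. fst (snd (bs ! b))"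
  have "?L b \<le> ?R b" if "b < length bs" for b
    using list_all2_nthD2[OF Bs that] by (auto simp: good_block_def split: prod.splits)
  moreover have "card {b \<in> {..<length bs}. ?L b \<le> p \<and> p \<le> ?R b} \<le> m" for p
    using load[of p] by (simp add: load_def length_filter_conv_card split_beta)
  ultimately obtain \<pi> where "\<forall>b\<in>{..<length bs}. \<pi> b < m"
    "\<forall>b\<in>{..<length bs}. \<forall>b'\<in>{..<length bs}. b \<noteq> b' \<longrightarrow> ?L b \<le> ?R b' \<longrightarrow> ?L b' \<le> ?R b \<longrightarrow> \<pi> b \<noteq> \<pi> b'"
    using interval_palettes[of "{..<length bs}" ?L ?R m] by auto
  then obtain col where col: "kd_coloring k d (intervals (concat Bs)) col"
    "\<forall>i<length (concat Bs). col i < m * X"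
    using blocks_offline[OF Bs, of \<pi> m] by fastforce
  have "card (col ` {..<length (intervals (concat Bs))}) \<le> card {..<m * X}"
    using col(2) by (intro card_mono) (auto simp: intervals_def)
  then show ?thesis unfolding colorable_def using col(1) by (intro exI[of _ col]) (simp del: of_nat_mult)
qed

section \<open>From the game on blocks to the game on intervals\<close>

lemma force_good_block:
  assumes s: "s \<ge> 1" and ds: "d \<le> s * ((2 * s) choose s)" and k: "k \<ge> 1" and lr: "l \<le> r"
    and Bs: "list_all2 (good_block k d (2 * s + d div k)) Bs bs"
  shows "forceable k d (\<lambda>h'. \<exists>B D. h' = concat Bs @ B \<and>
      good_block k d (2 * s + d div k) B (l, r, D) \<and> real d / real s \<le> real (card D) \<and>
      (\<forall>(l', r', D')\<in>set bs. l \<le> r' \<longrightarrow> l' \<le> r \<longrightarrow> D \<inter> D' = {})) (concat Bs)"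
proof -
  let ?h = "concat Bs"
  have good: "\<exists>t\<in>set bs. good_block k d (2 * s + d div k) B t" if "B \<in> set Bs" for B
    using Bs that by (metis in_set_conv_nth list_all2_conv_all_nth)
  have pos: "0 < weight (fst y) j" if "y \<in> set ?h" "j < d" for y j
    using good that by (fastforce simp: good_block_def)
  have ends: "left_end (fst y) \<le> right_end (fst y)" if "y \<in> set ?h" for y
    using good that by (fastforce simp: good_block_def)
  \<comment> \<open>Inserting 1 makes the set nonempty even before the first bundle and caps
    \<open>\<eta>\<close> at 1.\<close>
  define W where "W = insert 1 ((\<lambda>(y, j). weight (fst y) j) ` (set ?h \<times> {..<d}))"
  have W: "finite W" "W \<noteq> {}" by (auto simp: W_def)
  define \<eta> where "\<eta> = Min W"
  have \<eta>: "\<eta> > 0" "\<eta> \<le> 1" using W pos by (auto simp: \<eta>_def W_def)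
  have \<eta>_le: "\<eta> \<le> weight (fst y) j" if "y \<in> set ?h" "j < d" for y j
    unfolding \<eta>_def using W that by (intro Min_le) (auto simp: W_def)
  \<comment> \<open>\<open>Suc d\<close> keeps the denominator positive for every \<open>d\<close>.
    The resulting \<open>\<delta>\<close> satisfies \<open>2 * d ^ 2 * \<delta> \<le> \<eta>\<close>
    and \<open>d * \<delta> \<le> \<eta> / 2\<close>, strictly below every earlier weight.\<close>
  define e where "e = real (Suc d)"
  define \<delta> where "\<delta> = \<eta> / (2 * e\<^sup>2)"
  have e: "e > 0" "real d \<le> e" "1 \<le> e" by (auto simp: e_def)
  have \<delta>: "\<delta> > 0" using \<eta> e by (simp add: \<delta>_def)
  have "2 * (real d)\<^sup>2 * \<delta> \<le> 2 * e\<^sup>2 * \<delta>"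
    using \<delta> e by (intro mult_right_mono mult_left_mono power_mono) auto
  also have "\<dots> = \<eta>" using e by (simp add: \<delta>_def)
  finally have \<delta>2: "2 * (real d)\<^sup>2 * \<delta> \<le> 1" using \<eta> by linarith
  have "real d * \<delta> \<le> e\<^sup>2 * \<delta>"
    using \<delta> e by (intro mult_right_mono) (auto simp: power2_eq_square intro: order_trans[OF _ mult_left_mono[of 1 e e]])
  also have "\<dots> = \<eta> / 2" using e by (simp add: \<delta>_def)
  finally have \<delta>3: "real d * \<delta> < \<eta>" using \<eta> by linarith
  have "forceable k d (\<lambda>h'. \<exists>B. h' = ?h @ B \<and> hs_state d s \<delta> l r B \<and> fresh_block ?h l r B \<and>
    d \<le> s * card (snd ` set B)) (?h @ [])"
  proof (rule force_hs_block[OF s ds lr \<delta> \<delta>2 ends])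
    show "real d * \<delta> < weight (fst y) j" if "y \<in> set ?h" "j < d" for y j
      using \<delta>3 \<eta>_le[OF that] by linarith
  qed (auto simp: hs_state_def fresh_block_def)
  then have "forceable k d (\<lambda>h'. \<exists>B. h' = ?h @ B \<and> hs_state d s \<delta> l r B \<and> fresh_block ?h l r B \<and>
    d \<le> s * card (snd ` set B)) ?h" by simp
  then show ?thesis
  proof (rule forceable_trans, elim exE conjE, intro forceable.stop)
    fix h' B
    assume h': "h' = ?h @ B" and B: "hs_state d s \<delta> l r B" and fresh: "fresh_block ?h l r B"
      and card: "d \<le> s * card (snd ` set B)"
    let ?D = "snd ` set B"
    have "good_block k d (2 * s + d div k) B (l, r, ?D)"
      using hs_state_offline[OF B k \<delta> \<delta>2] hs_state_weights[OF B \<delta> \<delta>2] lr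
      by (simp add: good_block_def)
    moreover have "real d / real s \<le> real (card ?D)"
    proof -
      have "real d \<le> real s * real (card ?D)" using card by (metis of_nat_le_iff of_nat_mult)
      then show ?thesis using s by (simp add: field_simps)
    qed
    moreover have "?D \<inter> D' = {}" if t: "(l', r', D') \<in> set bs" "l \<le> r'" "l' \<le> r" for l' r' D'
    proof -
      obtain b where b: "b < length bs" "bs ! b = (l', r', D')" using t(1) by (auto simp: in_set_conv_nth)
      then have gb: "good_block k d (2 * s + d div k) (Bs ! b) (l', r', D')" "Bs ! b \<in> set Bs"
        using list_all2_nthD2[OF Bs b(1)] list_all2_lengthD[OF Bs] by auto
      have "c \<notin> ?D" if "c \<in> D'" for c
      proof -
        have "c \<in> snd ` set (Bs ! b)" using gb(1) that by (simp add: good_block_def)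
        then obtain v where v: "(v, c) \<in> set (Bs ! b)" by auto
        then have "(v, c) \<in> set ?h" "left_end v = l'" "right_end v = r'"
          using gb by (auto simp: good_block_def dest: bspec[OF _ v])
        then show ?thesis using fresh t unfolding fresh_block_def by blast
      qed
      then show ?thesis by blast
    qed
    ultimately show "\<exists>B D. h' = ?h @ B \<and> good_block k d (2 * s + d div k) B (l, r, D) \<and>
      real d / real s \<le> real (card D) \<and>
      (\<forall>(l', r', D')\<in>set bs. l \<le> r' \<longrightarrow> l' \<le> r \<longrightarrow> D \<inter> D' = {})"
      using h' by blast
  qed
qed

text \<open>Each block move is carried out as a bundle of intervals. The colors Algorithm uses on it
  form a legal answer in the game on blocks, so forcing there transfers.\<close>

lemma block_forceable_imp_forceable:
  assumes s: "s \<ge> 1" and ds: "d \<le> s * ((2 * s) choose s)" and k: "k \<ge> 1"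
    and "block_forceable (real d / real s) P bs"
    and "list_all2 (good_block k d (2 * s + d div k)) Bs bs"
  shows "forceable k d (\<lambda>h. \<exists>Bs bs. h = concat Bs \<and>
    list_all2 (good_block k d (2 * s + d div k)) Bs bs \<and> P bs) (concat Bs)"
  using assms(4,5)
proof (induction arbitrary: Bs rule: block_forceable.induct)
  case (stop bs)
  then show ?case by (intro forceable.stop) blast
next
  case (step l r bs)
  show ?case
  proof (rule forceable_trans[OF force_good_block[OF s ds k step.hyps(1) step.prems]], elim exE conjE)
    fix h' B D
    assume h': "h' = concat Bs @ B" and B: "good_block k d (2 * s + d div k) B (l, r, D)"
      and D: "real d / real s \<le> real (card D)"
        "\<forall>(l', r', D')\<in>set bs. l \<le> r' \<longrightarrow> l' \<le> r \<longrightarrow> D \<inter> D' = {}"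
    have "finite D" using B by (simp add: good_block_def)
    moreover have "list_all2 (good_block k d (2 * s + d div k)) (Bs @ [B]) (bs @ [(l, r, D)])"
      using step.prems B by (simp add: list_all2_appendI)
    ultimately have "forceable k d (\<lambda>h. \<exists>Bs bs. h = concat Bs \<and>
      list_all2 (good_block k d (2 * s + d div k)) Bs bs \<and> P bs) (concat (Bs @ [B]))"
      using D by (intro step.IH) auto
    then show "forceable k d (\<lambda>h. \<exists>Bs bs. h = concat Bs \<and>
      list_all2 (good_block k d (2 * s + d div k)) Bs bs \<and> P bs) h'"
      by (simp add: h')
  qed
qed

subsection \<open>The lower bound\<close>

text \<open>Take the largest integer \<open>s\<close> with \<open>2 * s \<le> log 2 d + 3\<close>.
  Then \<open>4 ^ s > 2 * d\<close>, and \<open>4 ^ s \<le> 2 * s * ((2 * s) choose s)\<close> gives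
  the last claim.\<close>

lemma central_binomial_parameter:
  fixes d :: nat
  assumes "d \<ge> 1"
  obtains s :: nat where "s \<ge> 1" "2 * real s \<le> log 2 (real d) + 3" "d \<le> s * ((2 * s) choose s)"
proof -
  define L where "L = log 2 (real d)"
  have L: "L \<ge> 0" "2 powr L = real d" using assms by (simp_all add: L_def)
  define z where "z = \<lfloor>(L + 3) / 2\<rfloor>"
  define s where "s = nat z"
  have z: "of_int z \<le> (L + 3) / 2" "(L + 3) / 2 < of_int z + 1"
    unfolding z_def using floor_correct[of "(L + 3) / 2"] by auto
  have "1 \<le> z" unfolding z_def le_floor_iff using L(1) by simp
  then have s1: "s \<ge> 1" and "real s = of_int z" by (simp_all add: s_def)
  with z have s: "2 * real s \<le> L + 3" "L + 1 < 2 * real s" by (simp_all add: field_simps)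
  have "2 * real d = 2 powr (L + 1)" using L(2) by (simp add: powr_add)
  also have "\<dots> \<le> 2 powr real (2 * s)" using s by (intro powr_mono) auto
  also have "\<dots> = 4 ^ s" by (subst powr_realpow) (simp_all add: power_mult)
  also have "\<dots> \<le> 2 * real s * real ((2 * s) choose s)"
    using central_binomial_lower_bound[of s] s1 by (simp add: field_simps)
  finally have "real d \<le> real (s * ((2 * s) choose s))" by simp
  then have "d \<le> s * ((2 * s) choose s)" by (simp only: of_nat_le_iff)
  with s s1 show ?thesis unfolding L_def by (intro that)
qed

theorem theorem3:
  fixes d k m :: nat
  assumes "d \<ge> 2" and "k \<ge> 1" and "m \<ge> 1"
  shows "\<exists>\<sigma>. presenter_strategy k d \<sigma> \<and>
    forces k d \<sigma>
      ((5 * real m - 3) * (real d / (log 2 (real d) + 3)))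
      (real m * (real d / real k + log 2 (real d) + 3))"
proof -
  define L where "L = log 2 (real d)"
  have L: "L \<ge> 0" using assms(1) by (simp add: L_def)
  obtain s :: nat where s: "s \<ge> 1" "2 * real s \<le> L + 3" and ds: "d \<le> s * ((2 * s) choose s)"
    using central_binomial_parameter[of d] assms(1) unfolding L_def by auto
  let ?q = "real d / real s" and ?X = "2 * s + d div k"
  have "forceable k d (\<lambda>h. \<exists>Bs bs. h = concat Bs \<and> list_all2 (good_block k d ?X) Bs bs \<and>
      (\<exists>e. bs = [] @ e \<and> (\<forall>t\<in>set e. inside 0 1 t) \<and> (\<forall>p. load e p \<le> m) \<and>
        (5 * real m - 3) * (?q / 2) \<le> real (card (cols e)))) (concat [])"
    by (rule block_forceable_imp_forceable[OF s(1) ds assms(2) force_blocks])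
      (use assms(3) in auto)
  then have "forceable k d (\<lambda>h. \<exists>Bs bs. h = concat Bs \<and> list_all2 (good_block k d ?X) Bs bs \<and>
      (\<exists>e. bs = [] @ e \<and> (\<forall>t\<in>set e. inside 0 1 t) \<and> (\<forall>p. load e p \<le> m) \<and>
        (5 * real m - 3) * (?q / 2) \<le> real (card (cols e)))) []" by (simp only: concat.simps)
  then have "forceable k d (\<lambda>h. \<exists>Bs bs. h = concat Bs \<and> list_all2 (good_block k d ?X) Bs bs \<and>
      (\<forall>p. load bs p \<le> m) \<and> (5 * real m - 3) * (?q / 2) \<le> real (card (cols bs))) []"
    by (rule forceable_trans) (intro forceable.stop, unfold append_Nil, blast)
  then obtain \<sigma> where \<sigma>: "presenter_strategy k d \<sigma>"
    and final: "\<And>h. play k d \<sigma> h \<Longrightarrow> \<sigma> h = None \<Longrightarrow> \<exists>Bs bs. h = concat Bs \<and>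
      list_all2 (good_block k d ?X) Bs bs \<and> (\<forall>p. load bs p \<le> m) \<and>
      (5 * real m - 3) * (?q / 2) \<le> real (card (cols bs))"
    using forceable_imp_strategy by blast
  have "forces k d \<sigma> ((5 * real m - 3) * (real d / (L + 3))) (real m * (real d / real k + L + 3))"
    unfolding forces_def
  proof (intro allI impI)
    fix h assume "play k d \<sigma> h" "\<sigma> h = None"
    from final[OF this] obtain Bs bs where h: "h = concat Bs"
      and Bs: "list_all2 (good_block k d ?X) Bs bs" and load: "\<And>p. load bs p \<le> m"
      and card: "(5 * real m - 3) * (?q / 2) \<le> real (card (cols bs))" by blast
    have "cols bs \<subseteq> set (map snd h)"
    proof
      fix c assume "c \<in> cols bs"
      then obtain l r D where t: "(l, r, D) \<in> set bs" "c \<in> D" by (auto simp: cols_def)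
      obtain B where "B \<in> set Bs" "good_block k d ?X B (l, r, D)"
        using Bs t(1) by (metis in_set_conv_nth list_all2_conv_all_nth)
      then show "c \<in> set (map snd h)" using t(2) by (auto simp: h good_block_def)
    qed
    then have "card (cols bs) \<le> card (set (map snd h))" by (intro card_mono) auto
    \<comment> \<open>As \<open>2 * s \<le> L + 3\<close>, half of \<open>d / s\<close> is at least
      \<open>d / (L + 3)\<close>. The same inequality then bounds the palette size
      \<open>2 * s + d div k\<close>.\<close>
    moreover have "(5 * real m - 3) * (real d / (L + 3)) \<le> (5 * real m - 3) * (?q / 2)"
    proof (rule mult_left_mono)
      have "real d / (L + 3) \<le> real d / (2 * real s)"
        using s L by (intro divide_left_mono) auto
      then show "real d / (L + 3) \<le> ?q / 2" by simp
    qed (use assms(3) in auto)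
    ultimately have "(5 * real m - 3) * (real d / (L + 3)) \<le> real (card (set (map snd h)))"
      using card by linarith
    moreover have "real (m * ?X) \<le> real m * (real d / real k + L + 3)"
      unfolding of_nat_mult
    proof (rule mult_left_mono)
      have "real (d div k) \<le> real d / real k" by (rule of_nat_div_le_of_nat)
      then show "real (2 * s + d div k) \<le> real d / real k + L + 3" using s(2) by simp
    qed simp
    then have "colorable k d (real m * (real d / real k + L + 3)) (intervals h)"
      using blocks_colorable[OF Bs load] unfolding colorable_def h by (meson order_trans)
    ultimately show "(5 * real m - 3) * (real d / (L + 3)) \<le> real (card (set (map snd h))) \<and>
        colorable k d (real m * (real d / real k + L + 3)) (intervals h)" by blast
  qed
  with \<sigma> show ?thesis unfolding L_def by blast
qed

end
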